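(* Let $a$ be a nonnegative integer, $b$ a positive integer and $\rho\in(0,1)$ a real number, and suppose that the improper integral $\int_0^{+\infty}\frac{\sin^b x}{x^{a+\rho}}\,dx$ converges. Then $$\int_0^{+\infty}\frac{\sin^b x}{x^{a+\rho}}\,dx=\frac{\pi}{2^{b-1}\,\Gamma(a+\rho)}\left|\sum_{k=1}^{b}k^{a+\rho-1}\,t_k\,C_b^{\frac{b-k}{2}}\,\frac{\sin\frac{(a+b+\rho)\pi}{2}}{\sin\rho\pi}\right|,$$ where, for $1\le k\le b$, $$t_k=\frac{\left[1+(-1)^{b-k}\right](-1)^{\lfloor k/2\rfloor}}{2}.$$
   Context: $\Gamma$ is the Gamma function and $C_n^m=\binom{n}{m}$ is the binomial coefficient. When $b-k$ is odd, $t_k=0$ and the corresponding term of the sum is taken to be $0$, so only $k$ with the same parity as $b$ contribute. The integral $\int_0^{+\infty} f(x)\,dx$ is an improper Riemann integral at both ends: it converges if both $\lim_{\varepsilon\to 0^+}\int_\varepsilon^1 f(x)\,dx$ and $\lim_{R\to+\infty}\int_1^R f(x)\,dx$ exist and are finite. *)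

theory Defs
  imports "HOL-Analysis.Analysis"
begin

text \<open>
  Improper integral over the half-line \<open>(0, \<infinity>)\<close>, improper at both ends and split at 1. The proper
  integrals over compact subintervals are the library's gauge integrals; for integrands that are
  continuous on \<open>(0, \<infinity>)\<close> these are the Riemann integrals. The first conjunct is needed because
  \<^term>\<open>integral\<close> is 0 by convention for functions that are not integrable.
\<close>

definition has_improper_integral :: "(real \<Rightarrow> real) \<Rightarrow> real \<Rightarrow> bool" where
  "has_improper_integral f I \<longleftrightarrow>
     (\<forall>u v. 0 < u \<and> u \<le> v \<longrightarrow> f integrable_on {u..v}) \<and>
     (\<exists>L M. ((\<lambda>\<epsilon>. integral {\<epsilon>..1} f) \<longlongrightarrow> L) (at_right 0) \<and>
            ((\<lambda>R. integral {1..R} f) \<longlongrightarrow> M) at_top \<and>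
            I = L + M)"

definition improper_integral_converges :: "(real \<Rightarrow> real) \<Rightarrow> bool" where
  "improper_integral_converges f \<longleftrightarrow> (\<exists>I. has_improper_integral f I)"

lemma has_improper_integral_unique:
  assumes "has_improper_integral f I" "has_improper_integral f J"
  shows "I = J"
proof -
  obtain L M where LM: "((\<lambda>\<epsilon>. integral {\<epsilon>..1} f) \<longlongrightarrow> L) (at_right 0)"
    "((\<lambda>R. integral {1..R} f) \<longlongrightarrow> M) at_top" "I = L + M"
    using assms(1) unfolding has_improper_integral_def by blast
  obtain L' M' where LM': "((\<lambda>\<epsilon>. integral {\<epsilon>..1} f) \<longlongrightarrow> L') (at_right 0)"
    "((\<lambda>R. integral {1..R} f) \<longlongrightarrow> M') at_top" "J = L' + M'"
    using assms(2) unfolding has_improper_integral_def by blast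
  have "L = L'" using tendsto_unique[OF _ LM(1) LM'(1)] by simp
  moreover have "M = M'" using tendsto_unique[OF _ LM(2) LM'(2)] by simp
  ultimately show ?thesis using LM(3) LM'(3) by simp
qed

text \<open>Used only for \<open>k \<le> b\<close>, so the subtraction does not truncate.\<close>

definition t_coeff :: "nat \<Rightarrow> nat \<Rightarrow> real" where
  "t_coeff b k = (1 + (-1) ^ (b - k)) * (-1) ^ (k div 2) / 2"

text \<open>
  In expressions \<open>t_coeff b k * (b choose ((b - k) div 2))\<close> the rounding in \<open>div\<close> is harmless:
\<close>

lemma t_coeff_odd: "odd (b - k) \<Longrightarrow> t_coeff b k = 0"
  by (simp add: t_coeff_def)

end

theory Submission
  imports Defs
begin

text \<open>
  Write \<open>sin\<^sup>b x\<close> as a constant plus a combination of the phase-shifted waves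
  \<open>cos (kx - b\<pi>/2)\<close>. Convergence forces \<open>a \<le> b\<close>, so \<open>a\<close> integrations by parts, whose boundary
  terms vanish because the \<open>i\<close>-th derivative of \<open>sin\<^sup>b\<close> is divisible by \<open>sin\<^bsup>b-i\<^esup>\<close>, lower the exponent
  to \<open>\<rho>\<close>. The constant disappears: by differentiation if \<open>a > 0\<close>, and by convergence at infinity if
  \<open>a = 0\<close>. There remain the integrals of \<open>cos (x + \<phi>) / x\<^sup>\<rho>\<close>, which are computed by writing
  \<open>\<Gamma>(\<rho>) x\<^bsup>-\<rho>\<^esup>\<close> as the Laplace transform of \<open>u\<^bsup>\<rho>-1\<^esup>\<close> and exchanging the integrations.
  This gives the formula up to a sign, and the integral is nonnegative.
\<close>

subsection \<open>Improper integrals via primitives\<close>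

text \<open>Encoding convergence by one antiderivative with limits at both ends turns linearity,
  substitution and integration by parts into differentiation rules plus limit rules, with no cut at
  1.\<close>

definition improper_primitive :: "(real \<Rightarrow> real) \<Rightarrow> real \<Rightarrow> bool" where
  "improper_primitive f I \<longleftrightarrow> (\<exists>F A B. (\<forall>x>0. (F has_real_derivative f x) (at x)) \<and>
     (F \<longlongrightarrow> A) (at_right 0) \<and> (F \<longlongrightarrow> B) at_top \<and> I = B - A)"

lemma has_integral_primitive:
  assumes "\<And>x. x > 0 \<Longrightarrow> (F has_real_derivative f x) (at x)" "0 < u" "u \<le> v"
  shows "(f has_integral (F v - F u)) {u..v}"
  using assms
  by (intro fundamental_theorem_of_calculus)
     (auto simp flip: has_real_derivative_iff_has_vector_derivative
       intro: has_field_derivative_at_within)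

lemma improper_primitive_imp_has_improper_integral:
  assumes "improper_primitive f I"
  shows "has_improper_integral f I"
proof -
  obtain F A B where F: "\<And>x. x > 0 \<Longrightarrow> (F has_real_derivative f x) (at x)"
    "(F \<longlongrightarrow> A) (at_right 0)" "(F \<longlongrightarrow> B) at_top" "I = B - A"
    using assms unfolding improper_primitive_def by blast
  note int = has_integral_primitive[of F f, OF F(1)]
  have "((\<lambda>\<epsilon>. integral {\<epsilon>..1} f) \<longlongrightarrow> F 1 - A) (at_right 0)"
  proof (rule Lim_transform_eventually)
    show "((\<lambda>\<epsilon>. F 1 - F \<epsilon>) \<longlongrightarrow> F 1 - A) (at_right 0)"
      by (intro tendsto_intros F)
    show "\<forall>\<^sub>F \<epsilon> in at_right 0. F 1 - F \<epsilon> = integral {\<epsilon>..1} f"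
      using eventually_at_right_real[of 0 1]
      by (auto elim!: eventually_mono simp: int[THEN integral_unique, of _ 1])
  qed
  moreover have "((\<lambda>R. integral {1..R} f) \<longlongrightarrow> B - F 1) at_top"
  proof (rule Lim_transform_eventually)
    show "((\<lambda>R. F R - F 1) \<longlongrightarrow> B - F 1) at_top"
      by (intro tendsto_intros F)
    show "\<forall>\<^sub>F R in at_top. F R - F 1 = integral {1..R} f"
      using eventually_ge_at_top[of 1]
      by eventually_elim (use int[THEN integral_unique, of 1] in auto)
  qed
  ultimately show ?thesis
    unfolding has_improper_integral_def using int F(4)
    by (intro conjI exI[of _ "F 1 - A"] exI[of _ "B - F 1"]) (auto intro: has_integral_integrable)
qed

text \<open>Continuity lets the fundamental theorem differentiate the indefinite integral at every
  positive point, so for continuous integrands the two notions agree.\<close>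

lemma has_improper_integral_imp_improper_primitive:
  assumes "has_improper_integral f I" and cont: "continuous_on {0<..} f"
  shows "improper_primitive f I"
proof -
  obtain L M where LM: "((\<lambda>\<epsilon>. integral {\<epsilon>..1} f) \<longlongrightarrow> L) (at_right 0)"
      "((\<lambda>R. integral {1..R} f) \<longlongrightarrow> M) at_top" "I = L + M"
    and int: "\<And>u v. 0 < u \<Longrightarrow> u \<le> v \<Longrightarrow> f integrable_on {u..v}"
    using assms unfolding has_improper_integral_def by blast
  \<comment> \<open>The signed integral from 1 to \<open>x\<close>; its limits at the two ends are
    \<open>- L\<close> and \<open>M\<close>.\<close>
  define F where "F = (\<lambda>x. if x \<le> 1 then - integral {x..1} f else integral {1..x} f)"
  \<comment> \<open>To the right of \<open>u\<close>, \<open>F\<close> differs by a constant from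
    the integral based at \<open>u\<close>, so the case split at 1 does not disturb
    differentiation.\<close>
  have eq: "F x = integral {u..x} f - integral {u..1} f" if "0 < u" "u \<le> 1" "u \<le> x" for u x
  proof (cases "x \<le> 1")
    case True
    have "integral {u..x} f + integral {x..1} f = integral {u..1} f"
      using True that by (intro Henstock_Kurzweil_Integration.integral_combine int) auto
    then show ?thesis using True by (simp add: F_def)
  next
    case False
    have "integral {u..1} f + integral {1..x} f = integral {u..x} f"
      using False that by (intro Henstock_Kurzweil_Integration.integral_combine int) auto
    then show ?thesis using False by (simp add: F_def)
  qed
  have deriv: "(F has_real_derivative f x) (at x)" if "x > 0" for x
  proof -
    define u where "u = min (x/2) 1"
    have u: "0 < u" "u \<le> 1" "u < x" using that by (auto simp: u_def min_def)
    have c: "continuous_on {u..x+1} f"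
      using u by (intro continuous_on_subset[OF cont]) auto
    have "((\<lambda>y. integral {u..y} f) has_real_derivative f x) (at x within {u..x+1})"
      using u c by (intro integral_has_real_derivative) auto
    then have "((\<lambda>y. integral {u..y} f) has_real_derivative f x) (at x)"
      using u by (subst (asm) at_within_interior) auto
    then have "((\<lambda>y. integral {u..y} f - integral {u..1} f) has_real_derivative f x) (at x)"
      by (auto intro!: derivative_eq_intros)
    then show ?thesis
    proof (rule has_field_derivative_transform_within_open[where S = "{u<..}"])
      fix y assume "y \<in> {u<..}"
      then show "integral {u..y} f - integral {u..1} f = F y"
        using eq[of u y] u by auto
    qed (use u in auto)
  qed
  have "(F \<longlongrightarrow> - L) (at_right 0)"
  proof (rule Lim_transform_eventually)
    show "((\<lambda>\<epsilon>. - integral {\<epsilon>..1} f) \<longlongrightarrow> - L) (at_right 0)"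
      by (intro tendsto_intros LM)
    show "\<forall>\<^sub>F \<epsilon> in at_right 0. - integral {\<epsilon>..1} f = F \<epsilon>"
      using eventually_at_right_real[of 0 1]
      by (auto elim!: eventually_mono simp: F_def)
  qed
  moreover have "(F \<longlongrightarrow> M) at_top"
  proof (rule Lim_transform_eventually)
    show "((\<lambda>R. integral {1..R} f) \<longlongrightarrow> M) at_top"
      by (intro tendsto_intros LM)
    show "\<forall>\<^sub>F R in at_top. integral {1..R} f = F R"
      using eventually_gt_at_top[of 1]
      by eventually_elim (simp add: F_def)
  qed
  ultimately show ?thesis
    unfolding improper_primitive_def using deriv LM(3) by (intro exI[of _ F] exI[of _ "-L"] exI[of _ M]) auto
qed

lemma improper_primitive_add:
  assumes "improper_primitive f I" "improper_primitive g J"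
  shows "improper_primitive (\<lambda>x. f x + g x) (I + J)"
proof -
  obtain F A B where F: "\<And>x. x > 0 \<Longrightarrow> (F has_real_derivative f x) (at x)"
    "(F \<longlongrightarrow> A) (at_right 0)" "(F \<longlongrightarrow> B) at_top" "I = B - A"
    using assms(1) unfolding improper_primitive_def by blast
  obtain G A' B' where G: "\<And>x. x > 0 \<Longrightarrow> (G has_real_derivative g x) (at x)"
    "(G \<longlongrightarrow> A') (at_right 0)" "(G \<longlongrightarrow> B') at_top" "J = B' - A'"
    using assms(2) unfolding improper_primitive_def by blast
  show ?thesis unfolding improper_primitive_def
    by (intro exI[of _ "\<lambda>x. F x + G x"] exI[of _ "A + A'"] exI[of _ "B + B'"])
       (auto intro!: derivative_intros tendsto_intros F G simp: F(4) G(4))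
qed

lemma improper_primitive_cmult:
  assumes "improper_primitive f I"
  shows "improper_primitive (\<lambda>x. c * f x) (c * I)"
proof -
  obtain F A B where F: "\<And>x. x > 0 \<Longrightarrow> (F has_real_derivative f x) (at x)"
    "(F \<longlongrightarrow> A) (at_right 0)" "(F \<longlongrightarrow> B) at_top" "I = B - A"
    using assms(1) unfolding improper_primitive_def by blast
  show ?thesis unfolding improper_primitive_def
    by (intro exI[of _ "\<lambda>x. c * F x"] exI[of _ "c * A"] exI[of _ "c * B"])
       (auto intro!: DERIV_cmult tendsto_mult_left F simp: F(4) right_diff_distrib)
qed

lemma improper_primitive_sum:
  assumes "finite K" "\<And>k. k \<in> K \<Longrightarrow> improper_primitive (f k) (I k)"
  shows "improper_primitive (\<lambda>x. \<Sum>k\<in>K. f k x) (\<Sum>k\<in>K. I k)"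
  using assms
proof (induction K rule: finite_induct)
  case empty
  have "improper_primitive (\<lambda>x. 0) 0"
    unfolding improper_primitive_def by (intro exI[of _ "\<lambda>_. 0"] exI[of _ 0]) auto
  then show ?case by simp
qed (auto intro: improper_primitive_add)

lemma improper_primitive_cong:
  assumes "improper_primitive f I" "\<And>x. x > 0 \<Longrightarrow> f x = g x"
  shows "improper_primitive g I"
  using assms unfolding improper_primitive_def by simp

text \<open>Chain rule for \<open>F (k * x)\<close>; as \<open>k > 0\<close>, the map
  \<open>x \<mapsto> k * x\<close> preserves the ends 0 and infinity.\<close>

lemma improper_primitive_scale:
  assumes "improper_primitive f I" "k > 0"
  shows "improper_primitive (\<lambda>x. k * f (k * x)) I"
proof -
  obtain F A B where F: "\<And>x. x > 0 \<Longrightarrow> (F has_real_derivative f x) (at x)"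
    "(F \<longlongrightarrow> A) (at_right 0)" "(F \<longlongrightarrow> B) at_top" "I = B - A"
    using assms(1) unfolding improper_primitive_def by blast
  have "filterlim (\<lambda>x. k * x) (at_right 0) (at_right 0)"
    unfolding filterlim_at using assms(2) eventually_at_right_less[of "0::real"]
    by (auto intro!: tendsto_eq_intros elim!: eventually_mono)
  moreover have "filterlim (\<lambda>x. k * x) at_top at_top"
    using assms(2) by (intro filterlim_tendsto_pos_mult_at_top[OF tendsto_const] filterlim_ident)
  ultimately show ?thesis unfolding improper_primitive_def
    using F(4) assms(2)
    by (intro exI[of _ "\<lambda>x. F (k * x)"] exI[of _ A] exI[of _ B])
       (auto intro!: DERIV_chain2[OF F(1), THEN DERIV_cong] derivative_eq_intros
         filterlim_compose[OF F(2)] filterlim_compose[OF F(3)])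
qed

text \<open>The derivative of \<open>f x / x powr c\<close> is
  \<open>f' x / x powr c - c * f x / x powr (c + 1)\<close>. Boundedness of \<open>f\<close> removes
  the boundary term at infinity, \<open>lim0\<close> the one at 0.\<close>

lemma improper_primitive_by_parts:
  assumes "improper_primitive (\<lambda>x. f' x / x powr c) I" "c > 0"
    and deriv: "\<And>x. x > 0 \<Longrightarrow> (f has_real_derivative f' x) (at x)"
    and bounded: "\<And>x. \<bar>f x\<bar> \<le> C"
    and lim0: "((\<lambda>x. f x / x powr c) \<longlongrightarrow> 0) (at_right 0)"
  shows "improper_primitive (\<lambda>x. f x / x powr (c + 1)) (I / c)"
proof -
  obtain F A B where F: "\<And>x. x > 0 \<Longrightarrow> (F has_real_derivative f' x / x powr c) (at x)"
    "(F \<longlongrightarrow> A) (at_right 0)" "(F \<longlongrightarrow> B) at_top" "I = B - A"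
    using assms(1) unfolding improper_primitive_def by blast
  have lim1: "((\<lambda>x. f x / x powr c) \<longlongrightarrow> 0) at_top"
  proof (rule Lim_null_comparison)
    show "((\<lambda>x. C * x powr (-c)) \<longlongrightarrow> 0) at_top"
      using tendsto_mult[OF tendsto_const tendsto_neg_powr[OF _ filterlim_ident], of "-c" C] \<open>c > 0\<close> by simp
    show "\<forall>\<^sub>F x in at_top. norm (f x / x powr c) \<le> C * x powr (-c)"
      using bounded by (auto simp: powr_minus divide_simps)
  qed
  define G where "G = (\<lambda>x. (F x - f x / x powr c) / c)"
  have "(G \<longlongrightarrow> (A - 0) / c) (at_right 0)" "(G \<longlongrightarrow> (B - 0) / c) at_top"
    unfolding G_def using \<open>c > 0\<close> by (intro tendsto_intros F lim0 lim1; simp)+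
  moreover have "(G has_real_derivative f x / x powr (c + 1)) (at x)" if "x > 0" for x
    unfolding G_def using that \<open>c > 0\<close>
    by (auto intro!: derivative_eq_intros F deriv simp: powr_add powr_diff field_simps)
  ultimately show ?thesis unfolding improper_primitive_def
    using F(4) by (intro exI[of _ G] exI[of _ "A/c"] exI[of _ "B/c"]) (auto simp: diff_divide_distrib)
qed

subsection \<open>The integral of a shifted cosine over a power\<close>

lemma has_bochner_integral_of_has_integral_nonneg:
  fixes f :: "real \<Rightarrow> real"
  assumes "(f has_integral I) S" "\<And>x. x \<in> S \<Longrightarrow> 0 \<le> f x"
    and [measurable]: "f \<in> borel_measurable borel" "S \<in> sets borel"
  shows "has_bochner_integral lborel (\<lambda>x. indicator S x * f x) I"
proof (rule has_bochner_integral_nn_integral)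
  show "(\<integral>\<^sup>+x. ennreal (indicator S x * f x) \<partial>lborel) = ennreal I"
    using assms by (intro nn_integral_has_integral_lebesgue)
  show "0 \<le> I" using assms has_integral_nonneg by blast
qed (use assms in \<open>auto simp: indicator_def\<close>)

text \<open>Substitute \<open>t = x * u\<close> in the Gamma integral. Read from right to left, this
  writes \<open>x powr (- r)\<close> as a Laplace transform.\<close>

lemma has_bochner_integral_Gamma_scaled:
  fixes x r :: real
  assumes "r > 0" "x > 0"
  shows "has_bochner_integral lborel (\<lambda>u. indicator {0..} u * (u powr (r - 1) * exp (- (x * u))))
    (Gamma r * x powr (- r))"
proof -
  have "has_bochner_integral lborel (\<lambda>t. indicator {0..} t * (t powr (r - 1) / exp t)) (Gamma r)"
    using assms by (intro has_bochner_integral_of_has_integral_nonneg Gamma_integral_real) auto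
  then have "has_bochner_integral lborel
      (\<lambda>u. indicator {0..} (0 + x * u) * ((0 + x * u) powr (r - 1) / exp (0 + x * u))) (Gamma r /\<^sub>R \<bar>x\<bar>)"
    using assms by (subst (asm) lborel_has_bochner_integral_real_affine_iff[where c = x and t = 0]) auto
  \<comment> \<open>The factor \<open>x powr (1 - r)\<close> cancels the power of \<open>x\<close>
    that comes out of \<open>(x * u) powr (r - 1)\<close>.\<close>
  then have "has_bochner_integral lborel
      (\<lambda>u. x powr (1 - r) * (indicator {0..} (0 + x * u) * ((0 + x * u) powr (r - 1) / exp (0 + x * u))))
      (x powr (1 - r) * (Gamma r /\<^sub>R \<bar>x\<bar>))"
    by (intro has_bochner_integral_mult_right) auto
  also have "(\<lambda>u. x powr (1 - r) * (indicator {0..} (0 + x * u) * ((0 + x * u) powr (r - 1) / exp (0 + x * u)))) =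
      (\<lambda>u. indicator {0..} u * (u powr (r - 1) * exp (- (x * u))))"
    using assms by (auto simp: indicator_def zero_le_mult_iff powr_mult exp_minus field_simps powr_diff
        intro!: ext)
  also have "x powr (1 - r) * (Gamma r /\<^sub>R \<bar>x\<bar>) = Gamma r * x powr (- r)"
    using assms by (simp add: powr_diff powr_minus field_simps)
  finally show ?thesis .
qed

text \<open>Transferred from the complex identity. At integers both sides are 0 by the conventions
  for poles and for division by 0.\<close>

lemma Gamma_reflection_real:
  fixes q :: real
  shows "Gamma q * Gamma (1 - q) = pi / sin (pi * q)"
proof -
  have "complex_of_real (Gamma q * Gamma (1 - q)) = complex_of_real (pi / sin (pi * q))"
    using Gamma_reflection_complex[of "of_real q"]
    by (simp flip: Gamma_complex_of_real sin_of_real)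
  then show ?thesis by (rule of_real_eq_iff[THEN iffD1])
qed

text \<open>The substitution \<open>t = u\<^sup>2 / (1 + u\<^sup>2)\<close> turns this into the Beta integral
  \<open>B(p/2, 1 - p/2) / 2\<close>.\<close>

lemma has_bochner_integral_powr_div_one_plus_square:
  fixes p :: real
  assumes p: "0 < p" "p < 2"
  shows "has_bochner_integral lborel (\<lambda>u. indicator {0<..} u * (u powr (p - 1) / (1 + u\<^sup>2)))
    (pi / (2 * sin (pi * p / 2)))"
proof (rule has_bochner_integral_of_has_integral_nonneg)
  define g g' where "g = (\<lambda>u::real. u\<^sup>2 / (1 + u\<^sup>2))" and "g' = (\<lambda>u::real. 2 * u / (1 + u\<^sup>2)\<^sup>2)"
  define f where "f = (\<lambda>t::real. t powr (p/2 - 1) * (1 - t) powr (1 - p/2 - 1))"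
  have pos: "1 + u\<^sup>2 > 0" for u :: real by (simp add: add_pos_nonneg)
  have g_pos: "0 < g u" "g u < 1" if "u > 0" for u
    using that pos[of u] by (auto simp: g_def)
  have img: "g ` {0<..} = {0<..<1}"
  proof (intro equalityI subsetI)
    fix t :: real assume t: "t \<in> {0<..<1}"
    \<comment> \<open>The inverse of \<open>g\<close>, obtained by solving
      \<open>t = u^2 / (1 + u^2)\<close> for \<open>u\<close>.\<close>
    have "t = g (sqrt (t / (1 - t)))" "sqrt (t / (1 - t)) > 0"
      using t by (auto simp: g_def field_simps)
    then show "t \<in> g ` {0<..}" by blast
  qed (use g_pos in auto)
  have inj: "inj_on g {0<..}"
  proof (rule inj_onI)
    fix x y :: real assume "x \<in> {0<..}" "y \<in> {0<..}" "g x = g y"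
    then have "x\<^sup>2 = y\<^sup>2" using pos[of x] pos[of y] by (simp add: g_def field_simps)
    then show "x = y" using \<open>x \<in> _\<close> \<open>y \<in> _\<close> by (auto simp: power2_eq_iff)
  qed
  have der: "(g has_field_derivative g' x) (at x within {0<..})" for x
    unfolding g_def g'_def using pos[of x]
    by (auto intro!: derivative_eq_intros simp: power2_eq_square field_simps)
  have beta: "(f has_integral Beta (p/2) (1 - p/2)) {0<..<1}"
    unfolding f_def has_integral_Icc_iff_Ioo[symmetric] using p by (intro has_integral_Beta_real) auto
  have "f absolutely_integrable_on {0<..<1} \<and> integral {0<..<1} f = Beta (p/2) (1 - p/2)"
    using beta by (auto intro!: nonnegative_absolutely_integrable_1 simp: integral_unique f_def
      dest: has_integral_integrable)
  then have ac: "(\<lambda>x. \<bar>g' x\<bar> * f (g x)) absolutely_integrable_on {0<..} \<and>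
      integral {0<..} (\<lambda>x. \<bar>g' x\<bar> * f (g x)) = Beta (p/2) (1 - p/2)"
    using has_absolute_integral_change_of_variables_1'[of "{0<..}" g g' f, OF _ der inj] img by auto
  have hi: "((\<lambda>x. \<bar>g' x\<bar> * f (g x)) has_integral Beta (p/2) (1 - p/2)) {0<..}"
    using ac set_lebesgue_integral_eq_integral(1) has_integral_integral by metis
  \<comment> \<open>With \<open>w = 1 + u^2\<close>, the three factors contribute \<open>w\<close>
    to the powers \<open>-2\<close>, \<open>1 - p/2\<close> and \<open>p/2\<close>, which leaves
    \<open>1 / w\<close>; the powers of \<open>u\<close> are \<open>1\<close> and
    \<open>p - 2\<close>.\<close>
  have eq: "\<bar>g' u\<bar> * f (g u) = 2 * (u powr (p - 1) / (1 + u\<^sup>2))" if u: "u > 0" for u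
  proof -
    define w where "w = 1 + u\<^sup>2"
    have w: "w > 0" using pos w_def by simp
    have 1: "1 - g u = 1 / w" using w by (simp add: g_def w_def field_simps)
    have 2: "g u = u\<^sup>2 / w" by (simp add: g_def w_def)
    have 3: "(u\<^sup>2) powr (p/2 - 1) = u powr (p - 2)"
      using powr_powr[of u 2 "p/2 - 1"] u by (simp add: algebra_simps)
    have "g u powr (p/2 - 1) = u powr (p - 2) / w powr (p/2 - 1)"
      unfolding 2 using u w by (simp add: powr_divide 3)
    moreover have "(1 - g u) powr (1 - p/2 - 1) = w powr (p/2)"
      unfolding 1 using w by (simp add: powr_divide powr_minus field_simps)
    moreover have "\<bar>g' u\<bar> = 2 * u / w\<^sup>2" using u w by (simp add: g'_def w_def)
    moreover have "u powr (p - 1) = u * u powr (p - 2)"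
      using u by (simp add: powr_diff powr_numeral field_simps power2_eq_square)
    moreover have "w powr (p/2) = w * w powr (p/2 - 1)"
      using w by (simp add: powr_diff)
    ultimately show ?thesis
      using w u unfolding f_def w_def[symmetric] by (simp add: field_simps power2_eq_square)
  qed
  have "((\<lambda>u. 1/2 * (\<bar>g' u\<bar> * f (g u))) has_integral 1/2 * Beta (p/2) (1 - p/2)) {0<..}"
    by (intro has_integral_mult_right hi)
  then have "((\<lambda>u. u powr (p - 1) / (1 + u\<^sup>2)) has_integral 1/2 * Beta (p/2) (1 - p/2)) {0<..}"
    by (rule has_integral_eq[rotated]) (use eq in auto)
  also have "1/2 * Beta (p/2) (1 - p/2) = pi / (2 * sin (pi * p / 2))"
    using Gamma_reflection_real[of "p/2"] by (simp add: Beta_def)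
  finally show "((\<lambda>u. u powr (p - 1) / (1 + u\<^sup>2)) has_integral pi / (2 * sin (pi * p / 2))) {0<..}" .
qed (auto intro!: divide_nonneg_nonneg)

section \<open>Exchange of integrations and passage to the limit\<close>

lemma integral_exp_cos:
  fixes u \<phi> R :: real
  assumes "R \<ge> 0"
  shows "(\<integral>x. indicator {0<..R} x * (exp (- (x * u)) * cos (x + \<phi>)) \<partial>lborel) =
    (exp (- (R * u)) * (sin (R + \<phi>) - u * cos (R + \<phi>)) - (sin \<phi> - u * cos \<phi>)) / (1 + u\<^sup>2)"
proof -
  have pos: "1 + u\<^sup>2 > 0" by (simp add: add_pos_nonneg)
  have "(\<integral>x. indicator {0<..R} x * (exp (- (x * u)) * cos (x + \<phi>)) \<partial>lborel) =
    (\<integral>x. (exp (- (x * u)) * cos (x + \<phi>)) * indicator {0..R} x \<partial>lborel)"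
    using AE_lborel_singleton[of 0]
    by (intro integral_cong_AE) (auto simp: indicator_def elim!: eventually_mono)
  also have "\<dots> = exp (- (R * u)) * (sin (R + \<phi>) - u * cos (R + \<phi>)) / (1 + u\<^sup>2) -
      exp (- (0 * u)) * (sin (0 + \<phi>) - u * cos (0 + \<phi>)) / (1 + u\<^sup>2)"
  proof (rule integral_FTC_Icc_real[OF assms])
    fix x
    \<comment> \<open>Up to the factor \<open>1 + u^2\<close>, this is the antiderivative that two
      integrations by parts produce.\<close>
    have "((\<lambda>x. exp (- (x * u)) * (sin (x + \<phi>) - u * cos (x + \<phi>)))
        has_real_derivative exp (- (x * u)) * cos (x + \<phi>) * (1 + u\<^sup>2)) (at x)"
      by (auto intro!: derivative_eq_intros simp: algebra_simps power2_eq_square)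
    from DERIV_cdivide[OF this, of "1 + u\<^sup>2"] show "((\<lambda>x. exp (- (x * u)) * (sin (x + \<phi>) - u * cos (x + \<phi>)) / (1 + u\<^sup>2))
        has_real_derivative exp (- (x * u)) * cos (x + \<phi>)) (at x)"
      using pos by simp
  qed auto
  finally show ?thesis by (simp add: diff_divide_distrib)
qed

text \<open>Dominated by \<open>x powr (- \<rho>)\<close>, which is integrable at 0 because
  \<open>\<rho> < 1\<close>.\<close>

lemma integrable_cos_div_powr:
  fixes \<rho> \<phi> R :: real
  assumes "\<rho> < 1" "R \<ge> 0"
  shows "integrable lborel (\<lambda>x. indicator {0<..R} x * (cos (x + \<phi>) * x powr (- \<rho>)))"
proof (rule Bochner_Integration.integrable_bound)
  have "(\<lambda>x. x powr (- \<rho>)) integrable_on {0<..R}"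
    using assms by (intro integrable_on_powr_from_0') auto
  then show "integrable lborel (\<lambda>x. indicator {0<..R} x * x powr (- \<rho>))"
    by (intro integrable.intros has_bochner_integral_of_has_integral_nonneg integrable_integral) auto
  show "AE x in lborel. norm (indicator {0<..R} x * (cos (x + \<phi>) * x powr (- \<rho>)))
      \<le> norm (indicator {0<..R} x * x powr (- \<rho>))"
    by (auto simp: indicator_def abs_mult mult_left_le_one_le)
qed auto

text \<open>The range of \<open>x\<close> is cut off at \<open>R\<close> because over the whole
  half-line the double integral does not converge absolutely; the limit in \<open>R\<close> is taken
  afterwards.\<close>

lemma Fubini_cos_div_powr:
  fixes \<rho> \<phi> R :: real
  assumes \<rho>: "0 < \<rho>" "\<rho> < 1" and R: "R \<ge> 0"
  shows "Gamma \<rho> * (\<integral>x. indicator {0<..R} x * (cos (x + \<phi>) * x powr (- \<rho>)) \<partial>lborel) =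
    (\<integral>u. indicator {0..} u * u powr (\<rho> - 1) *
       ((exp (- (R * u)) * (sin (R + \<phi>) - u * cos (R + \<phi>)) - (sin \<phi> - u * cos \<phi>)) / (1 + u\<^sup>2)) \<partial>lborel)"
proof -
  define f :: "real \<Rightarrow> real \<Rightarrow> real" where "f = (\<lambda>x u. indicator {0<..R} x * cos (x + \<phi>) *
      (indicator {0..} u * (u powr (\<rho> - 1) * exp (- (x * u)))))"
  have [measurable]: "case_prod f \<in> borel_measurable (lborel \<Otimes>\<^sub>M lborel)"
    unfolding f_def by measurable
  have inner: "has_bochner_integral lborel (f x) (indicator {0<..R} x * cos (x + \<phi>) * (Gamma \<rho> * x powr (- \<rho>)))" for x
  proof (cases "x > 0")
    case True
    then show ?thesis unfolding f_def
      using \<rho> by (intro has_bochner_integral_mult_right has_bochner_integral_Gamma_scaled) auto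
  qed (simp add: f_def has_bochner_integral_zero)
  \<comment> \<open>The kernel in \<open>u\<close> is nonnegative, so absolute values affect only
    the cosine and the inner integral is again the Gamma integral.\<close>
  have inner_norm: "(\<integral>u. norm (f x u) \<partial>lborel) =
      Gamma \<rho> * norm (indicator {0<..R} x * (cos (x + \<phi>) * x powr (- \<rho>)))" for x
  proof (cases "x > 0")
    case True
    have "(\<integral>u. norm (f x u) \<partial>lborel) = (\<integral>u. norm (indicator {0<..R} x * cos (x + \<phi>)) *
        (indicator {0..} u * (u powr (\<rho> - 1) * exp (- (x * u)))) \<partial>lborel)"
      by (intro Bochner_Integration.integral_cong) (auto simp: f_def abs_mult)
    also have "\<dots> = norm (indicator {0<..R} x * cos (x + \<phi>)) * (Gamma \<rho> * x powr (- \<rho>))"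
      using True \<rho> by (intro has_bochner_integral_integral_eq has_bochner_integral_mult_right
          has_bochner_integral_Gamma_scaled) auto
    finally show ?thesis by (simp add: abs_mult)
  qed (simp add: f_def)
  have "integrable (lborel \<Otimes>\<^sub>M lborel) (case_prod f)"
  proof (rule lborel_pair.Fubini_integrable)
    show "integrable lborel (\<lambda>x. \<integral>u. norm (case_prod f (x, u)) \<partial>lborel)"
      unfolding prod.case inner_norm using \<rho> R
      by (intro integrable_mult_right integrable_norm integrable_cos_div_powr)
    show "AE x in lborel. integrable lborel (\<lambda>u. case_prod f (x, u))"
      using integrable.intros[OF inner] by simp
  qed auto
  from lborel_pair.Fubini_integral[OF this]
  have "(\<integral>u. \<integral>x. f x u \<partial>lborel \<partial>lborel) =
      (\<integral>x. indicator {0<..R} x * cos (x + \<phi>) * (Gamma \<rho> * x powr (- \<rho>)) \<partial>lborel)"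
    using inner[THEN has_bochner_integral_integral_eq] by simp
  also have "\<dots> = (\<integral>x. Gamma \<rho> * (indicator {0<..R} x * (cos (x + \<phi>) * x powr (- \<rho>))) \<partial>lborel)"
    by (simp add: mult_ac)
  also have "\<dots> = Gamma \<rho> * (\<integral>x. indicator {0<..R} x * (cos (x + \<phi>) * x powr (- \<rho>)) \<partial>lborel)"
    by simp
  finally have "Gamma \<rho> * (\<integral>x. indicator {0<..R} x * (cos (x + \<phi>) * x powr (- \<rho>)) \<partial>lborel) =
      (\<integral>u. \<integral>x. f x u \<partial>lborel \<partial>lborel)" by simp
  also have "(\<lambda>u. \<integral>x. f x u \<partial>lborel) = (\<lambda>u. indicator {0..} u * u powr (\<rho> - 1) *
       ((exp (- (R * u)) * (sin (R + \<phi>) - u * cos (R + \<phi>)) - (sin \<phi> - u * cos \<phi>)) / (1 + u\<^sup>2)))"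
  proof
    fix u
    have "(\<integral>x. f x u \<partial>lborel) = (\<integral>x. indicator {0..} u * u powr (\<rho> - 1) *
        (indicator {0<..R} x * (exp (- (x * u)) * cos (x + \<phi>))) \<partial>lborel)"
      by (intro Bochner_Integration.integral_cong) (auto simp: f_def)
    then show "(\<integral>x. f x u \<partial>lborel) = indicator {0..} u * u powr (\<rho> - 1) *
       ((exp (- (R * u)) * (sin (R + \<phi>) - u * cos (R + \<phi>)) - (sin \<phi> - u * cos \<phi>)) / (1 + u\<^sup>2))"
      unfolding integral_exp_cos[OF R, symmetric] by simp
  qed
  finally show ?thesis .
qed

text \<open>By Fubini it suffices to let \<open>R\<close> grow in the integral over
  \<open>u\<close>. The exponential term dies, and the rest splits into the Beta-type integrals with
  \<open>p = \<rho> + 1\<close> and \<open>p = \<rho>\<close>.\<close>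

lemma tendsto_integral_cos_div_powr:
  fixes \<rho> \<phi> :: real
  assumes \<rho>: "0 < \<rho>" "\<rho> < 1"
  shows "((\<lambda>R. \<integral>x. indicator {0<..R} x * (cos (x + \<phi>) * x powr (- \<rho>)) \<partial>lborel) \<longlongrightarrow>
    pi * sin (pi * \<rho> / 2 - \<phi>) / (Gamma \<rho> * sin (\<rho> * pi))) at_top"
proof -
  \<comment> \<open>\<open>s R\<close> is the integrand in \<open>u\<close>, \<open>l\<close> its
    pointwise limit and \<open>w\<close> the dominating function. The indicators differ at
    \<open>u = 0\<close>, where \<open>0 powr (\<rho> - 1) = 0\<close> makes all three
    vanish.\<close>
  define s where "s = (\<lambda>R u. indicator {0..} u * u powr (\<rho> - 1) *
       ((exp (- (R * u)) * (sin (R + \<phi>) - u * cos (R + \<phi>)) - (sin \<phi> - u * cos \<phi>)) / (1 + u\<^sup>2)))"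
  define l where "l = (\<lambda>u. cos \<phi> * (indicator {0<..} u * (u powr ((\<rho> + 1) - 1) / (1 + u\<^sup>2))) -
      sin \<phi> * (indicator {0<..} u * (u powr (\<rho> - 1) / (1 + u\<^sup>2))))"
  define w where "w = (\<lambda>u::real. 2 * (indicator {0<..} u * (u powr ((\<rho> + 1) - 1) / (1 + u\<^sup>2))) +
      2 * (indicator {0<..} u * (u powr (\<rho> - 1) / (1 + u\<^sup>2))))"
  have pos: "1 + u\<^sup>2 > 0" for u :: real by (simp add: add_pos_nonneg)
  have B0: "has_bochner_integral lborel (\<lambda>u. indicator {0<..} u * (u powr (\<rho> - 1) / (1 + u\<^sup>2)))
      (pi / (2 * sin (pi * \<rho> / 2)))"
    using \<rho> by (intro has_bochner_integral_powr_div_one_plus_square) auto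
  have B1: "has_bochner_integral lborel (\<lambda>u. indicator {0<..} u * (u powr ((\<rho> + 1) - 1) / (1 + u\<^sup>2)))
      (pi / (2 * sin (pi * (\<rho> + 1) / 2)))"
    using \<rho> by (intro has_bochner_integral_powr_div_one_plus_square) auto
  have l_eq: "l u = indicator {0<..} u * u powr (\<rho> - 1) * ((u * cos \<phi> - sin \<phi>) / (1 + u\<^sup>2))" for u
  proof (cases "u > 0")
    case True
    then have "u powr ((\<rho> + 1) - 1) = u * u powr (\<rho> - 1)" by (simp add: powr_diff)
    then show ?thesis by (simp add: l_def diff_divide_distrib algebra_simps)
  qed (simp add: l_def)
  have [measurable]: "l \<in> borel_measurable lborel" "s R \<in> borel_measurable lborel" for R
    unfolding l_def s_def by measurable
  have "((\<lambda>R. integral\<^sup>L lborel (s R)) \<longlongrightarrow> integral\<^sup>L lborel l) at_top"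
  proof (rule integral_dominated_convergence_at_top)
    show "integrable lborel w" unfolding w_def
      using B0 B1 by (intro Bochner_Integration.integrable_add integrable_mult_right) (auto intro: integrable.intros)
    show "AE u in lborel. ((\<lambda>R. s R u) \<longlongrightarrow> l u) at_top"
    proof (intro always_eventually allI)
      fix u :: real
      show "((\<lambda>R. s R u) \<longlongrightarrow> l u) at_top"
      proof (cases "u > 0")
        case True
        have e: "((\<lambda>R. exp (- (R * u)) * (sin (R + \<phi>) - u * cos (R + \<phi>))) \<longlongrightarrow> 0) at_top"
        proof (rule Lim_null_comparison)
          have "((\<lambda>R. exp (- (R * u))) \<longlongrightarrow> 0) at_top"
            using True by (intro filterlim_compose[OF exp_at_bot] filterlim_uminus_at_top[THEN iffD1]
                filterlim_at_top_mult_tendsto_pos[OF tendsto_const] filterlim_ident)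
          then show "((\<lambda>R. exp (- (R * u)) * (1 + u)) \<longlongrightarrow> 0) at_top"
            by (rule tendsto_mult_left_zero)
          have "\<bar>sin (R + \<phi>) - u * cos (R + \<phi>)\<bar> \<le> 1 + u" for R
          proof -
            have "\<bar>u * cos (R + \<phi>)\<bar> \<le> u * 1"
              unfolding abs_mult using True by (intro mult_mono) auto
            then show ?thesis using abs_sin_le_one[of "R + \<phi>"] by linarith
          qed
          then show "\<forall>\<^sub>F R in at_top. norm (exp (- (R * u)) * (sin (R + \<phi>) - u * cos (R + \<phi>)))
              \<le> exp (- (R * u)) * (1 + u)"
            by (simp add: abs_mult)
        qed
        have "((\<lambda>R. s R u) \<longlongrightarrow> indicator {0..} u * u powr (\<rho> - 1) * ((0 - (sin \<phi> - u * cos \<phi>)) / (1 + u\<^sup>2))) at_top"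
          unfolding s_def using pos[of u] by (intro tendsto_intros e) auto
        then show ?thesis using True by (simp add: l_eq)
      qed (auto simp: s_def l_def indicator_def)
    qed
    show "\<forall>\<^sub>F R in at_top. AE u in lborel. norm (s R u) \<le> w u"
      using eventually_ge_at_top[of 0]
    proof eventually_elim
      fix R :: real assume R: "R \<ge> 0"
      show "AE u in lborel. norm (s R u) \<le> w u"
      proof (intro always_eventually allI)
        fix u :: real
        show "norm (s R u) \<le> w u"
        proof (cases "u > 0")
          case True
          \<comment> \<open>This bound serves both the term at \<open>R\<close> and the term at 0,
            whence the factors 2 in \<open>w\<close>.\<close>
          have b: "\<bar>sin y - u * cos y\<bar> \<le> 1 + u" for y
          proof -
            have "\<bar>u * cos y\<bar> \<le> u * 1"
              unfolding abs_mult using True by (intro mult_mono) auto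
            then show ?thesis using abs_sin_le_one[of y] by linarith
          qed
          have e: "\<bar>exp (- (R * u)) * (sin (R + \<phi>) - u * cos (R + \<phi>))\<bar> \<le> 1 * (1 + u)"
            unfolding abs_mult using True R b by (intro mult_mono) auto
          have tri: "\<bar>p - q\<bar> \<le> 2 + 2 * u"
            if "\<bar>p\<bar> \<le> 1 * (1 + u)" "\<bar>q\<bar> \<le> 1 + u" for p q :: real
            using that abs_triangle_ineq4[of p q] by simp
          have "\<bar>exp (- (R * u)) * (sin (R + \<phi>) - u * cos (R + \<phi>)) - (sin \<phi> - u * cos \<phi>)\<bar> \<le> 2 + 2 * u"
            by (rule tri[OF e b])
          then have "norm (s R u) \<le> u powr (\<rho> - 1) * ((2 + 2 * u) / (1 + u\<^sup>2))"
            using True pos[of u] by (auto simp: s_def abs_mult intro!: divide_right_mono mult_left_mono)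
          also have "\<dots> = w u"
          proof -
            have "u powr ((\<rho> + 1) - 1) = u * u powr (\<rho> - 1)" using True by (simp add: powr_diff)
            then show ?thesis using True by (simp add: w_def add_divide_distrib algebra_simps)
          qed
          finally show ?thesis .
        qed (auto simp: s_def w_def indicator_def)
      qed
    qed
  qed auto
  also have "integral\<^sup>L lborel l = cos \<phi> * (pi / (2 * sin (pi * (\<rho> + 1) / 2))) - sin \<phi> * (pi / (2 * sin (pi * \<rho> / 2)))"
    unfolding l_def using B0 B1
    by (intro has_bochner_integral_integral_eq has_bochner_integral_diff has_bochner_integral_mult_right) auto
  also have "\<dots> = pi * sin (pi * \<rho> / 2 - \<phi>) / sin (\<rho> * pi)"
  proof -
    \<comment> \<open>In the half angle \<open>h\<close> the two denominators are
      \<open>2 * cos h\<close> and \<open>2 * sin h\<close>, and their product gives the double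
      angle \<open>sin (\<rho> * pi)\<close>.\<close>
    define h where "h = pi * \<rho> / 2"
    have "0 < h" "h < pi / 2" using \<rho> by (auto simp: h_def)
    then have sc: "sin h > 0" "cos h > 0"
      by (auto intro!: sin_gt_zero2 cos_gt_zero)
    have 1: "sin (pi * (\<rho> + 1) / 2) = cos h"
      using sin_add[of h "pi/2"] by (simp add: h_def field_simps)
    have 2: "sin (\<rho> * pi) = 2 * sin h * cos h"
      using sin_double[of h] by (simp add: h_def mult.commute)
    show ?thesis
      unfolding 1 2 h_def[symmetric] sin_diff using sc by (simp add: field_simps)
  qed
  finally have lim: "((\<lambda>R. integral\<^sup>L lborel (s R)) \<longlongrightarrow> pi * sin (pi * \<rho> / 2 - \<phi>) / sin (\<rho> * pi)) at_top" .
  have G: "Gamma \<rho> > 0" using \<rho> by (intro Gamma_real_pos) auto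
  have "((\<lambda>R. integral\<^sup>L lborel (s R) / Gamma \<rho>) \<longlongrightarrow> pi * sin (pi * \<rho> / 2 - \<phi>) / sin (\<rho> * pi) / Gamma \<rho>) at_top"
    using G by (intro tendsto_divide lim) auto
  then show ?thesis
  proof (rule Lim_transform_eventually[THEN tendsto_eq_rhs])
    show "\<forall>\<^sub>F R in at_top. integral\<^sup>L lborel (s R) / Gamma \<rho> =
        (\<integral>x. indicator {0<..R} x * (cos (x + \<phi>) * x powr (- \<rho>)) \<partial>lborel)"
      using eventually_ge_at_top[of 0]
    proof eventually_elim
      case (elim R)
      show ?case using Fubini_cos_div_powr[OF \<rho> elim, of \<phi>] G
        by (simp add: s_def field_simps)
    qed
  qed (simp add: mult.commute)
qed

text \<open>Absolute integrability near 0 makes the integral from 0 continuous in its upper end,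
  which gives the limit at 0; the limit at infinity is
  \<open>tendsto_integral_cos_div_powr\<close>.\<close>

lemma improper_primitive_cos_div_powr:
  fixes \<rho> \<phi> :: real
  assumes \<rho>: "0 < \<rho>" "\<rho> < 1"
  shows "improper_primitive (\<lambda>x. cos (x + \<phi>) / x powr \<rho>)
    (pi * sin (pi * \<rho> / 2 - \<phi>) / (Gamma \<rho> * sin (\<rho> * pi)))"
    (is "improper_primitive ?f ?V")
proof (rule has_improper_integral_imp_improper_primitive)
  show cont: "continuous_on {0<..} ?f" by (intro continuous_intros) auto
  have eq: "cos (x + \<phi>) * x powr (- \<rho>) = ?f x" for x by (simp add: powr_minus field_simps)
  have int: "?f integrable_on {0..R}" and val: "integral {0..R} ?f =
      (\<integral>x. indicator {0<..R} x * (cos (x + \<phi>) * x powr (- \<rho>)) \<partial>lborel)" if "R \<ge> 0" for R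
  proof -
    have "set_integrable lborel {0<..R} ?f"
      using integrable_cos_div_powr[OF \<rho>(2) that, of \<phi>] by (simp add: set_integrable_def eq)
    note si = set_borel_integral_eq_integral[OF this]
    have "(?f has_integral integral {0<..R} ?f) {0<..R}" using si(1) by blast
    \<comment> \<open>Adding the endpoint 0 changes the domain by a null set.\<close>
    then have hi: "(?f has_integral integral {0<..R} ?f) {0..R}"
      by (subst has_integral_spike_set_eq[of _ "{0<..R}"]) (auto intro: negligible_subset[of "{0}"])
    then show "?f integrable_on {0..R}" by blast
    show "integral {0..R} ?f = (\<integral>x. indicator {0<..R} x * (cos (x + \<phi>) * x powr (- \<rho>)) \<partial>lborel)"
      using integral_unique[OF hi] si(2) by (simp add: set_lebesgue_integral_def eq)
  qed
  have split: "integral {0..u} ?f + integral {u..v} ?f = integral {0..v} ?f" if "0 \<le> u" "u \<le> v" for u v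
    using that by (intro Henstock_Kurzweil_Integration.integral_combine int) auto
  have "((\<lambda>u. integral {0..u} ?f) \<longlongrightarrow> integral {0..0} ?f) (at_right 0)"
  proof -
    have "continuous_on {0..1} (\<lambda>u. integral {0..u} ?f)"
      by (intro indefinite_integral_continuous_1 int) auto
    then have "((\<lambda>u. integral {0..u} ?f) \<longlongrightarrow> integral {0..0} ?f) (at 0 within {0..1})"
      unfolding continuous_on by (rule bspec) simp
    then show ?thesis by (simp add: at_within_Icc_at_right)
  qed
  then have lim0: "((\<lambda>u. integral {0..1} ?f - integral {0..u} ?f) \<longlongrightarrow> integral {0..1} ?f - 0) (at_right 0)"
    by (intro tendsto_intros) simp
  have limt: "((\<lambda>R. integral {0..R} ?f - integral {0..1} ?f) \<longlongrightarrow> ?V - integral {0..1} ?f) at_top"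
  proof (intro tendsto_intros)
    show "((\<lambda>R. integral {0..R} ?f) \<longlongrightarrow> ?V) at_top"
    proof (rule Lim_transform_eventually[OF tendsto_integral_cos_div_powr[OF \<rho>]])
      show "\<forall>\<^sub>F R in at_top. (\<integral>x. indicator {0<..R} x * (cos (x + \<phi>) * x powr (- \<rho>)) \<partial>lborel) =
          integral {0..R} ?f"
        using eventually_ge_at_top[of 0] by eventually_elim (simp add: val)
    qed
  qed
  show "has_improper_integral ?f ?V"
    unfolding has_improper_integral_def
  proof (intro conjI allI impI exI)
    fix u v :: real assume "0 < u \<and> u \<le> v"
    then show "?f integrable_on {u..v}"
      by (intro integrable_continuous_interval continuous_on_subset[OF cont]) auto
  next
    show "((\<lambda>\<epsilon>. integral {\<epsilon>..1} ?f) \<longlongrightarrow> integral {0..1} ?f - 0) (at_right 0)"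
    proof (rule Lim_transform_eventually[OF lim0])
      show "\<forall>\<^sub>F \<epsilon> in at_right 0. integral {0..1} ?f - integral {0..\<epsilon>} ?f = integral {\<epsilon>..1} ?f"
        using eventually_at_right_real[of "0::real" 1, OF zero_less_one]
      proof eventually_elim
        case (elim \<epsilon>)
        then show ?case using split[of \<epsilon> 1] by simp
      qed
    qed
    show "((\<lambda>R. integral {1..R} ?f) \<longlongrightarrow> ?V - integral {0..1} ?f) at_top"
    proof (rule Lim_transform_eventually[OF limt])
      show "\<forall>\<^sub>F R in at_top. integral {0..R} ?f - integral {0..1} ?f = integral {1..R} ?f"
        using eventually_ge_at_top[of 1]
      proof eventually_elim
        case (elim R)
        then show ?case using split[of 1 R] by simp
      qed
    qed
  qed simp
qed

subsection \<open>Powers of the sine as trigonometric sums\<close>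

text \<open>Binomial expansion of the power of \<open>(cis x - cis (- x)) / (2 * \<i>)\<close>.
  Writing \<open>1 / \<i>\<close> as \<open>cis (- (pi / 2))\<close> turns it into the phase shift
  by \<open>b * pi / 2\<close>, which treats both parities of \<open>b\<close> at once.\<close>

lemma sin_power_eq_sum_cos:
  fixes x :: real
  shows "sin x ^ b = (\<Sum>j\<le>b. (-1) ^ j * real (b choose j) *
    cos ((real b - 2 * real j) * x - real b * pi / 2)) / 2 ^ b"
proof -
  have "complex_of_real (sin x) = cis (- (pi / 2)) / 2 * ((- cis (- x)) + cis x)"
    by (simp add: complex_eq_iff)
  then have "complex_of_real (sin x ^ b) = (cis (- (pi / 2)) / 2) ^ b * ((- cis (- x)) + cis x) ^ b"
    by (simp only: power_mult_distrib of_real_power)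
  also have "(cis (- (pi / 2)) / 2) ^ b = cis (- (real b * pi / 2)) / 2 ^ b"
    using Complex.DeMoivre[of "- (pi / 2)" b] by (simp add: power_divide del: cis_minus_pi_half)
  also have "((- cis (- x)) + cis x) ^ b =
      (\<Sum>j\<le>b. of_real ((-1) ^ j * real (b choose j)) * cis ((real b - 2 * real j) * x))"
    unfolding binomial_ring
  proof (intro sum.cong refl)
    fix j assume "j \<in> {..b}"
    then have "(- cis (- x)) ^ j * cis x ^ (b - j) = of_real ((-1) ^ j) * cis ((real b - 2 * real j) * x)"
      unfolding power_minus[of "cis (- x)"] Complex.DeMoivre
      by (simp add: cis_mult of_nat_diff algebra_simps)
    then show "of_nat (b choose j) * (- cis (- x)) ^ j * cis x ^ (b - j) =
        of_real ((-1) ^ j * real (b choose j)) * cis ((real b - 2 * real j) * x)"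
      by (simp add: mult_ac)
  qed
  also have "cis (- (real b * pi / 2)) / 2 ^ b * \<dots> = (\<Sum>j\<le>b. of_real ((-1) ^ j * real (b choose j) / 2 ^ b) *
      cis ((real b - 2 * real j) * x - real b * pi / 2))"
    by (simp add: sum_distrib_left cis_mult algebra_simps)
  finally have "Re (complex_of_real (sin x ^ b)) = Re \<dots>" by (rule arg_cong)
  moreover have "Re (complex_of_real c * cis t) = c * cos t" for c t by simp
  ultimately show ?thesis
    unfolding Re_sum Re_complex_of_real sum_divide_distrib by (simp only: times_divide_eq_left)
qed

text \<open>The terms \<open>j\<close> and \<open>b - j\<close> of the binomial expansion agree; the pair has frequency
  \<open>k = b - 2j\<close>, and the middle term (for even \<open>b\<close>) is the constant.\<close>

lemma sin_power_eq_t_coeff_sum: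
  assumes "b > 0"
  shows "\<exists>c0. \<forall>x. sin x ^ b = c0 + (-1) ^ (b div 2) / 2 ^ (b - 1) *
    (\<Sum>k=1..b. t_coeff b k * real (b choose ((b - k) div 2)) * cos (real k * x - real b * pi / 2))"
proof -
  define g where "g = (\<lambda>x j. (-1) ^ j * real (b choose j) *
    cos ((real b - 2 * real j) * x - real b * pi / 2))"
  \<comment> \<open>The index set is empty for odd \<open>b\<close>. For the middle index the
    frequency is 0, so \<open>g x j\<close> may be evaluated at \<open>x = 0\<close>.\<close>
  define c0 where "c0 = (\<Sum>j\<in>{j. j \<le> b \<and> 2 * j = b}. g 0 j) / 2 ^ b"
  have sym: "g x (b - j) = g x j" if "j \<le> b" for x j
  proof -
    have "cos ((real b - 2 * real (b - j)) * x - real b * pi / 2) =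
        cos (- ((real b - 2 * real (b - j)) * x - real b * pi / 2))"
      by (rule cos_minus[symmetric])
    \<comment> \<open>Reversing the sign of the argument restores the frequency but flips the phase;
      the discrepancy \<open>b * pi\<close> costs the sign \<open>(-1) ^ b\<close>.\<close>
    also have "\<dots> = cos ((real b - 2 * real j) * x - real b * pi / 2 + real b * pi)"
      using that by (intro arg_cong[of _ _ cos]) (simp add: of_nat_diff algebra_simps)
    also have "\<dots> = (-1) ^ b * cos ((real b - 2 * real j) * x - real b * pi / 2)"
      using cos_add[of "(real b - 2 * real j) * x - real b * pi / 2" "real b * pi"]
      by (simp only: cos_npi sin_npi) simp
    finally have "g x (b - j) = (-1) ^ (b - j) * (-1) ^ b * real (b choose j) *
        cos ((real b - 2 * real j) * x - real b * pi / 2)"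
      using that by (simp add: g_def flip: binomial_symmetric)
    also have "(-1) ^ (b - j) * (-1) ^ b = ((-1) ^ j :: real)"
      using that by (simp add: power_diff_conv_inverse flip: power_mult_distrib)
    finally show ?thesis by (simp add: g_def)
  qed
  have half: "(\<Sum>j\<in>{j. 2 * j < b}. g x j) = (-1) ^ (b div 2) *
      (\<Sum>k=1..b. t_coeff b k * real (b choose ((b - k) div 2)) * cos (real k * x - real b * pi / 2))" for x
  proof -
    define G where "G = (\<lambda>k. (-1) ^ (b div 2) *
      (t_coeff b k * real (b choose ((b - k) div 2)) * cos (real k * x - real b * pi / 2)))"
    have "(\<Sum>j\<in>{j. 2 * j < b}. g x j) = (\<Sum>k\<in>{k\<in>{1..b}. even (b - k)}. G k)"
    proof (rule sum.reindex_bij_witness[of _ "\<lambda>k. (b - k) div 2" "\<lambda>j. b - 2 * j"])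
      fix j assume j: "j \<in> {j. 2 * j < b}"
      \<comment> \<open>Hence the global sign \<open>(-1) ^ (b div 2)\<close> converts the sign
        \<open>(-1) ^ (k div 2)\<close> in \<open>t_coeff\<close> into the binomial sign
        \<open>(-1) ^ j\<close>.\<close>
      then have "b div 2 = j + (b - 2 * j) div 2" by auto
      then have "(-1) ^ (b div 2) * (-1) ^ ((b - 2 * j) div 2) = ((-1) ^ j :: real)"
        by (simp add: power_add mult.assoc flip: power_mult_distrib)
      then show "G (b - 2 * j) = g x j"
        using j by (simp add: G_def g_def t_coeff_def of_nat_diff)
    qed auto
    also have "\<dots> = (\<Sum>k=1..b. G k)"
      by (rule sum.mono_neutral_left) (auto simp: G_def t_coeff_odd)
    finally show ?thesis by (simp add: G_def sum_distrib_left)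
  qed
  have "sin x ^ b = c0 + (-1) ^ (b div 2) / 2 ^ (b - 1) *
    (\<Sum>k=1..b. t_coeff b k * real (b choose ((b - k) div 2)) * cos (real k * x - real b * pi / 2))" for x
  proof -
    have "{..b} = {j. j \<le> b \<and> 2 * j = b} \<union> ({j. 2 * j < b} \<union> {j. j \<le> b \<and> 2 * j > b})"
      by auto
    then have "(\<Sum>j\<le>b. g x j) = (\<Sum>j\<in>{j. j \<le> b \<and> 2 * j = b} \<union> ({j. 2 * j < b} \<union> {j. j \<le> b \<and> 2 * j > b}). g x j)"
      by simp
    also have "\<dots> = (\<Sum>j\<in>{j. j \<le> b \<and> 2 * j = b}. g x j) +
        ((\<Sum>j\<in>{j. 2 * j < b}. g x j) + (\<Sum>j\<in>{j. j \<le> b \<and> 2 * j > b}. g x j))"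
    proof -
      have "finite {j. 2 * j < b}" by (rule finite_subset[of _ "{..b}"]) auto
      then show ?thesis by (subst sum.union_disjoint; (subst sum.union_disjoint)?) auto
    qed
    also have "(\<Sum>j\<in>{j. j \<le> b \<and> 2 * j > b}. g x j) = (\<Sum>j\<in>{j. 2 * j < b}. g x j)"
      by (rule sum.reindex_bij_witness[of _ "\<lambda>j. b - j" "\<lambda>j. b - j"]) (auto simp: sym)
    also have "(\<Sum>j\<in>{j. j \<le> b \<and> 2 * j = b}. g x j) = (\<Sum>j\<in>{j. j \<le> b \<and> 2 * j = b}. g 0 j)"
      by (intro sum.cong) (auto simp: g_def)
    finally have "sin x ^ b = c0 + 2 * (\<Sum>j\<in>{j. 2 * j < b}. g x j) / 2 ^ b"
      unfolding sin_power_eq_sum_cos c0_def g_def by (simp add: add_divide_distrib)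
    \<comment> \<open>The doubling from pairing the terms lowers the power of 2 to
      \<open>b - 1\<close>.\<close>
    moreover have "(2::real) ^ b = 2 * 2 ^ (b - 1)"
      using assms by (simp add: power_eq_if)
    ultimately show ?thesis unfolding half by simp
  qed
  then show ?thesis by blast
qed

subsection \<open>Iterated integration by parts\<close>

lemma improper_primitive_cos_scaled:
  fixes \<rho> \<phi> :: real
  assumes \<rho>: "0 < \<rho>" "\<rho> < 1" and "k > 0"
  shows "improper_primitive (\<lambda>x. cos (k * x + \<phi>) / x powr \<rho>)
    (k powr (\<rho> - 1) * (pi * sin (pi * \<rho> / 2 - \<phi>) / (Gamma \<rho> * sin (\<rho> * pi))))"
proof (rule improper_primitive_cong)
  show "improper_primitive (\<lambda>x. k powr (\<rho> - 1) * (k * (cos (k * x + \<phi>) / (k * x) powr \<rho>)))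
    (k powr (\<rho> - 1) * (pi * sin (pi * \<rho> / 2 - \<phi>) / (Gamma \<rho> * sin (\<rho> * pi))))"
    using improper_primitive_scale[OF improper_primitive_cos_div_powr[OF \<rho>] \<open>k > 0\<close>]
    by (rule improper_primitive_cmult)
  show "k powr (\<rho> - 1) * (k * (cos (k * x + \<phi>) / (k * x) powr \<rho>)) = cos (k * x + \<phi>) / x powr \<rho>"
    if "x > 0" for x
    using that \<open>k > 0\<close> by (simp add: powr_mult powr_diff field_simps)
qed

text \<open>Raising the exponent from \<open>\<rho>\<close> to \<open>a + \<rho>\<close> divides
  successively by \<open>\<rho>, \<rho> + 1, ..., \<rho> + a - 1\<close>, whose product is
  \<open>Gamma (a + \<rho>) / Gamma \<rho>\<close>. The induction runs on the shifted sequence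
  \<open>f (Suc i)\<close>.\<close>

lemma improper_primitive_iterated_by_parts:
  fixes f :: "nat \<Rightarrow> real \<Rightarrow> real" and \<rho> :: real
  assumes "\<rho> > 0"
    and "\<And>i x. (f i has_real_derivative f (Suc i) x) (at x)"
    and "\<And>i. \<exists>C. \<forall>x. \<bar>f i x\<bar> \<le> C"
    and "\<And>i. i < a \<Longrightarrow> ((\<lambda>x. f i x / x powr (real a - real i - 1 + \<rho>)) \<longlongrightarrow> 0) (at_right 0)"
    and "improper_primitive (\<lambda>x. f a x / x powr \<rho>) I"
  shows "improper_primitive (\<lambda>x. f 0 x / x powr (real a + \<rho>)) (I * Gamma \<rho> / Gamma (real a + \<rho>))"
  using assms(2-)
proof (induction a arbitrary: f)
  case 0
  have "Gamma \<rho> > 0" using \<open>\<rho> > 0\<close> by (rule Gamma_real_pos)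
  then show ?case using 0 by simp
next
  case (Suc a)
  have *: "improper_primitive (\<lambda>x. f (Suc 0) x / x powr (real a + \<rho>)) (I * Gamma \<rho> / Gamma (real a + \<rho>))"
    using Suc.prems(3)[of "Suc _"] Suc.prems(4)
    by (intro Suc.IH[of "\<lambda>i. f (Suc i)"] Suc.prems(1,2)) auto
  obtain C where C: "\<And>x. \<bar>f 0 x\<bar> \<le> C" using Suc.prems(2)[of 0] by auto
  have "((\<lambda>x. f 0 x / x powr (real a + \<rho>)) \<longlongrightarrow> 0) (at_right 0)"
    using Suc.prems(3)[of 0] by simp
  with * C Suc.prems(1) have "improper_primitive (\<lambda>x. f 0 x / x powr (real a + \<rho> + 1))
      (I * Gamma \<rho> / Gamma (real a + \<rho>) / (real a + \<rho>))"
    using \<open>\<rho> > 0\<close> by (intro improper_primitive_by_parts[where f' = "f (Suc 0)"]) auto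
  moreover have "Gamma (real a + \<rho> + 1) = (real a + \<rho>) * Gamma (real a + \<rho>)"
  proof (rule Gamma_plus1)
    show "real a + \<rho> \<notin> \<int>\<^sub>\<le>\<^sub>0"
      using \<open>\<rho> > 0\<close> by (auto elim!: nonpos_Ints_cases)
  qed
  ultimately show ?case by (simp add: add_ac mult_ac)
qed

section \<open>Order of vanishing at the origin\<close>

lemma tendsto_0_div_powr:
  fixes h :: "real \<Rightarrow> real"
  assumes "\<And>x. 0 < x \<Longrightarrow> x \<le> 1 \<Longrightarrow> \<bar>h x\<bar> \<le> C * x ^ n" "c < real n"
  shows "((\<lambda>x. h x / x powr c) \<longlongrightarrow> 0) (at_right 0)"
proof (rule Lim_null_comparison)
  have "((\<lambda>x. C * x powr (real n - c)) \<longlongrightarrow> C * 0 powr (real n - c)) (at_right 0)"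
    using assms(2) eventually_at_right_less[of "0::real"]
    by (intro tendsto_mult tendsto_const tendsto_powr' tendsto_ident_at) (auto elim!: eventually_mono)
  then show "((\<lambda>x. C * x powr (real n - c)) \<longlongrightarrow> 0) (at_right 0)" by simp
  show "\<forall>\<^sub>F x in at_right 0. norm (h x / x powr c) \<le> C * x powr (real n - c)"
    using eventually_at_right_real[of "0::real" 1, OF zero_less_one]
  proof eventually_elim
    case (elim x)
    then have "norm (h x / x powr c) \<le> C * x ^ n / x powr c"
      using assms(1)[of x] by (auto intro!: divide_right_mono simp: abs_divide)
    also have "\<dots> = C * x powr (real n - c)"
      using elim by (simp add: powr_diff powr_realpow)
    finally show ?case .
  qed
qed

text \<open>A syntactic form of divisibility by the \<open>n\<close>-th power of the sine.
  Differentiation preserves it at the cost of one order, so no formula for higher derivatives is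
  needed.\<close>

inductive sin_vanishing :: "nat \<Rightarrow> (real \<Rightarrow> real) \<Rightarrow> bool" where
  monomial: "n \<le> p \<Longrightarrow> sin_vanishing n (\<lambda>x. c * sin x ^ p * cos x ^ q)"
| sum: "sin_vanishing n f \<Longrightarrow> sin_vanishing n g \<Longrightarrow> sin_vanishing n (\<lambda>x. f x + g x)"

lemma sin_vanishing_derivative:
  assumes "sin_vanishing (Suc n) f"
  shows "\<exists>f'. sin_vanishing n f' \<and> (\<forall>x. (f has_real_derivative f' x) (at x))"
  using assms
proof (induction "Suc n" f rule: sin_vanishing.induct)
  case (monomial p c q)
  \<comment> \<open>Here \<open>p > 0\<close>, so \<open>p - 1\<close> does not truncate. For
    \<open>q = 0\<close> the truncated exponent is harmless, since its coefficient is 0.\<close>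
  let ?f' = "\<lambda>x. (c * real p) * sin x ^ (p - 1) * cos x ^ (q + 1) +
    (- c * real q) * sin x ^ (p + 1) * cos x ^ (q - 1)"
  have "sin_vanishing n ?f'"
    using monomial by (intro sin_vanishing.intros) auto
  moreover have "((\<lambda>x. c * sin x ^ p * cos x ^ q) has_real_derivative ?f' x) (at x)" for x
    by (auto intro!: derivative_eq_intros simp: algebra_simps)
  ultimately show ?case by blast
next
  case (sum f g)
  then obtain f' g' where "sin_vanishing n f'" "\<forall>x. (f has_real_derivative f' x) (at x)"
    "sin_vanishing n g'" "\<forall>x. (g has_real_derivative g' x) (at x)" by blast
  then show ?case
    by (intro exI[of _ "\<lambda>x. f' x + g' x"]) (auto intro!: sin_vanishing.sum derivative_intros)
qed

lemma sin_vanishing_bound: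
  assumes "sin_vanishing n f"
  shows "\<exists>C. \<forall>x. 0 < x \<longrightarrow> x \<le> 1 \<longrightarrow> \<bar>f x\<bar> \<le> C * x ^ n"
  using assms
proof (induction rule: sin_vanishing.induct)
  case (monomial n p c q)
  have "\<bar>c * sin x ^ p * cos x ^ q\<bar> \<le> \<bar>c\<bar> * x ^ n" if "0 < x" "x \<le> 1" for x
  proof -
    have "\<bar>sin x\<bar> ^ p \<le> x ^ p"
      using that abs_sin_x_le_abs_x[of x] by (intro power_mono) auto
    also have "\<dots> \<le> x ^ n" using that monomial by (intro power_decreasing) auto
    finally have "\<bar>sin x\<bar> ^ p * \<bar>cos x\<bar> ^ q \<le> x ^ n * 1"
      using that by (intro mult_mono power_le_one) auto
    then show ?thesis
      by (simp add: abs_mult power_abs mult.assoc mult_left_mono)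
  qed
  then show ?case by blast
next
  case (sum n f g)
  then obtain C D where "\<forall>x. 0 < x \<longrightarrow> x \<le> 1 \<longrightarrow> \<bar>f x\<bar> \<le> C * x ^ n"
    "\<forall>x. 0 < x \<longrightarrow> x \<le> 1 \<longrightarrow> \<bar>g x\<bar> \<le> D * x ^ n" by blast
  then have "\<forall>x. 0 < x \<longrightarrow> x \<le> 1 \<longrightarrow> \<bar>f x + g x\<bar> \<le> (C + D) * x ^ n"
    unfolding distrib_right by (meson abs_triangle_ineq add_mono order_trans)
  then show ?case by blast
qed

subsection \<open>Consequences of convergence, and the sign of the integral\<close>

text \<open>The derivative \<open>cos y - 1/2\<close> is nonnegative because
  \<open>1 < pi / 3\<close>.\<close>

lemma sin_ge_half_arg:
  fixes x :: real
  assumes "0 \<le> x" "x \<le> 1"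
  shows "x / 2 \<le> sin x"
proof -
  have "sin 0 - 0 / 2 \<le> sin x - x / 2"
  proof (rule DERIV_nonneg_imp_nondecreasing[OF assms(1)])
    fix y assume y: "0 \<le> y" "y \<le> x"
    have "cos (pi / 3) \<le> cos y"
      using y assms pi_gt3 by (intro cos_monotone_0_pi_le) auto
    then show "\<exists>d. ((\<lambda>x. sin x - x / 2) has_real_derivative d) (at y) \<and> 0 \<le> d"
      by (intro exI[of _ "cos y - 1/2"]) (auto intro!: derivative_eq_intros simp: cos_60)
  qed
  then show ?thesis by simp
qed

text \<open>If \<open>a\<close> were at least \<open>b + 1\<close>, the integrand would be at least
  \<open>c / x\<close> near 0, and a primitive would tend to minus infinity there like
  \<open>c * ln x\<close>.\<close>

lemma improper_sin_power_exponent_le: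
  fixes \<rho> :: real
  assumes "improper_primitive (\<lambda>x. sin x ^ b / x powr (real a + \<rho>)) I" "\<rho> \<ge> 0"
  shows "a \<le> b"
proof (rule ccontr)
  assume "\<not> a \<le> b"
  then have ab: "real b + 1 \<le> real a" by linarith
  obtain F A where F: "\<And>x. x > 0 \<Longrightarrow> (F has_real_derivative sin x ^ b / x powr (real a + \<rho>)) (at x)"
    "(F \<longlongrightarrow> A) (at_right 0)"
    using assms(1) unfolding improper_primitive_def by blast
  define c :: real where "c = 1 / 2 ^ b"
  have c: "c > 0" by (simp add: c_def)
  have lower: "c / x \<le> sin x ^ b / x powr (real a + \<rho>)" if x: "0 < x" "x \<le> 1" for x
  proof -
    have "c / x = c * x powr (-1)" using x by (simp add: powr_minus field_simps)
    also have "\<dots> \<le> c * x powr (real b - (real a + \<rho>))"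
      using x ab assms(2) c by (intro mult_left_mono powr_mono') auto
    also have "\<dots> = (x / 2) ^ b / x powr (real a + \<rho>)"
      using x by (simp add: c_def powr_diff powr_realpow power_divide)
    also have "\<dots> \<le> sin x ^ b / x powr (real a + \<rho>)"
      using x sin_ge_half_arg[of x] by (intro divide_right_mono power_mono) auto
    finally show ?thesis .
  qed
  have "F x \<le> F 1 + c * ln x" if x: "0 < x" "x \<le> 1" for x
  proof -
    have "F x - c * ln x \<le> F 1 - c * ln 1"
    proof (rule DERIV_nonneg_imp_nondecreasing[OF x(2)])
      fix y assume y: "x \<le> y" "y \<le> 1"
      then show "\<exists>d. ((\<lambda>x. F x - c * ln x) has_real_derivative d) (at y) \<and> 0 \<le> d"
        using x lower[of y]
        by (intro exI[of _ "sin y ^ b / y powr (real a + \<rho>) - c / y"])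
           (auto intro!: derivative_eq_intros F)
    qed
    then show ?thesis by simp
  qed
  then have "\<forall>\<^sub>F x in at_right 0. F x \<le> F 1 + c * ln x"
    using eventually_at_right_real[of "0::real" 1, OF zero_less_one] by (auto elim!: eventually_mono)
  moreover have "filterlim (\<lambda>x. c * ln x) at_bot (at_right 0)"
    using c by (intro filterlim_tendsto_pos_mult_at_bot[OF tendsto_const] ln_at_0)
  then have "\<forall>\<^sub>F x in at_right 0. c * ln x < A - 1 - F 1"
    unfolding filterlim_at_bot_dense by blast
  moreover have "\<forall>\<^sub>F x in at_right 0. A - 1 < F x"
    by (rule order_tendstoD(1)[OF F(2)]) simp
  ultimately have "\<forall>\<^sub>F x in at_right (0::real). False"
    by eventually_elim simp
  then show False by simp
qed

text \<open>Any primitive agrees up to a constant with a nonzero multiple of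
  \<open>x powr (1 - \<rho>)\<close>, which has no finite limit at infinity.\<close>

lemma not_improper_primitive_const_div_powr:
  fixes \<rho> c :: real
  assumes "\<rho> < 1" "improper_primitive (\<lambda>x. c / x powr \<rho>) I"
  shows "c = 0"
proof (rule ccontr)
  assume "c \<noteq> 0"
  obtain F B where F: "\<And>x. x > 0 \<Longrightarrow> (F has_real_derivative c / x powr \<rho>) (at x)"
    "(F \<longlongrightarrow> B) at_top"
    using assms(2) unfolding improper_primitive_def by blast
  define G where "G = (\<lambda>x. c / (1 - \<rho>) * x powr (1 - \<rho>))"
  have G: "(G has_real_derivative c / x powr \<rho>) (at x)" if "x > 0" for x
  proof -
    have "(G has_real_derivative c / (1 - \<rho>) * ((1 - \<rho>) * x powr (1 - \<rho> - 1))) (at x)"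
      unfolding G_def using that by (intro DERIV_cmult has_real_derivative_powr)
    moreover have "c / (1 - \<rho>) * ((1 - \<rho>) * x powr (1 - \<rho> - 1)) = c / x powr \<rho>"
      using assms(1) by (simp add: powr_minus_divide)
    ultimately show ?thesis by simp
  qed
  have "F x - F 1 = G x - G 1" if "x \<ge> 1" for x
    using has_integral_primitive[of F "\<lambda>x. c / x powr \<rho>", OF F(1), of 1 x]
      has_integral_primitive[of G "\<lambda>x. c / x powr \<rho>", OF G, of 1 x] that
    by (auto intro: has_integral_unique)
  \<comment> \<open>Solving for the power avoids distinguishing the sign of \<open>c\<close>: the
    power would converge, yet its product with a null function is 1.\<close>
  then have eq: "(F x - F 1 + G 1) * ((1 - \<rho>) / c) = x powr (1 - \<rho>)" if "x \<ge> 1" for x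
    using that \<open>c \<noteq> 0\<close> assms(1) by (simp add: G_def)
  have "\<forall>\<^sub>F x in at_top. (F x - F 1 + G 1) * ((1 - \<rho>) / c) = x powr (1 - \<rho>)"
    using eventually_ge_at_top[of "1::real"] by eventually_elim (rule eq)
  moreover have "((\<lambda>x. (F x - F 1 + G 1) * ((1 - \<rho>) / c)) \<longlongrightarrow> (B - F 1 + G 1) * ((1 - \<rho>) / c)) at_top"
    by (intro tendsto_intros F)
  ultimately have "((\<lambda>x. x powr (1 - \<rho>)) \<longlongrightarrow> (B - F 1 + G 1) * ((1 - \<rho>) / c)) at_top"
    by (rule Lim_transform_eventually[rotated])
  moreover have "((\<lambda>x::real. x powr (\<rho> - 1)) \<longlongrightarrow> 0) at_top"
    using assms(1) by (intro tendsto_neg_powr filterlim_ident) auto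
  ultimately have "((\<lambda>x. x powr (1 - \<rho>) * x powr (\<rho> - 1)) \<longlongrightarrow> (B - F 1 + G 1) * ((1 - \<rho>) / c) * 0) at_top"
    by (rule tendsto_mult)
  moreover have "\<forall>\<^sub>F x::real in at_top. x powr (1 - \<rho>) * x powr (\<rho> - 1) = 1"
    using eventually_gt_at_top[of "0::real"] by eventually_elim (simp flip: powr_add)
  ultimately have "((\<lambda>x::real. 1::real) \<longlongrightarrow> (B - F 1 + G 1) * ((1 - \<rho>) / c) * 0) at_top"
    by (rule Lim_transform_eventually)
  then show False by (simp add: tendsto_const_iff)
qed

section \<open>Nonnegativity of the integral\<close>

lemma tendsto_le_of_derivative_nonneg:
  fixes G :: "real \<Rightarrow> real"
  assumes G: "\<And>x. x > 0 \<Longrightarrow> (G has_real_derivative G' x) (at x)" "\<And>x. x > 0 \<Longrightarrow> 0 \<le> G' x"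
    and lim: "(G \<longlongrightarrow> A) (at_right 0)" "(G \<longlongrightarrow> B) at_top"
  shows "A \<le> B"
proof -
  have mono: "G x \<le> G y" if "0 < x" "x \<le> y" for x y
  proof (rule DERIV_nonneg_imp_nondecreasing[OF that(2)])
    fix z assume "x \<le> z"
    then have "0 < z" using that(1) by simp
    then show "\<exists>d. (G has_real_derivative d) (at z) \<and> 0 \<le> d" using G by blast
  qed
  have "A \<le> G 1"
  proof (rule tendsto_upperbound[OF lim(1)])
    show "\<forall>\<^sub>F x in at_right 0. G x \<le> G 1"
      using eventually_at_right_real[of "0::real" 1, OF zero_less_one]
      by (auto elim!: eventually_mono intro: mono)
  qed simp
  moreover have "G 1 \<le> B"
  proof (rule tendsto_lowerbound[OF lim(2)])
    show "\<forall>\<^sub>F x in at_top. G 1 \<le> G x"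
      using eventually_ge_at_top[of "1::real"] by eventually_elim (rule mono, simp_all)
  qed simp
  ultimately show ?thesis by simp
qed

text \<open>With \<open>b = 2 * m + 1\<close> and \<open>t = cos x\<close>, take for
  \<open>W x\<close> the integral of \<open>(1 - t^2) ^ m\<close> from \<open>cos x\<close> to 1; it
  is bounded because the cosine stays in \<open>[-1, 1]\<close>, where this integrand is
  nonnegative.\<close>

lemma odd_sin_power_nonneg_primitive:
  assumes "odd b"
  obtains W C where "\<And>x. (W has_real_derivative sin x ^ b) (at x)" "\<And>x. 0 \<le> W x" "\<And>x. W x \<le> C" "W 0 = 0"
proof -
  obtain m where b: "b = 2 * m + 1" using assms by (elim oddE)
  \<comment> \<open>The larger interval keeps -1 and 1 in the interior, so that \<open>P\<close> has
    two-sided derivatives there.\<close>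
  have "continuous_on {-2..2::real} (\<lambda>x. (1 - x\<^sup>2) ^ m)" by (intro continuous_intros)
  note deriv = integral_has_real_derivative[OF this]
  define P where "P = (\<lambda>x. integral {-2..x} (\<lambda>x::real. (1 - x\<^sup>2) ^ m))"
  have P: "(P has_real_derivative (1 - x\<^sup>2) ^ m) (at x)" if "\<bar>x\<bar> \<le> 1" for x
  proof -
    have x: "x \<in> {-2..2}" "x \<in> interior {-2..2}" using that by auto
    show ?thesis
      using deriv[OF x(1)] unfolding at_within_interior[OF x(2)] P_def .
  qed
  have mono: "P x \<le> P y" if "-1 \<le> x" "x \<le> y" "y \<le> 1" for x y
  proof (rule DERIV_nonneg_imp_nondecreasing[OF that(2)])
    fix z assume "x \<le> z" "z \<le> y"
    then have z: "\<bar>z\<bar> \<le> 1" using that by auto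
    then have "z\<^sup>2 \<le> 1" by (simp add: abs_square_le_1)
    then show "\<exists>d. (P has_real_derivative d) (at z) \<and> 0 \<le> d"
      using P[OF z] by (intro exI[of _ "(1 - z\<^sup>2) ^ m"]) auto
  qed
  show thesis
  proof (rule that[of "\<lambda>x. P 1 - P (cos x)" "P 1 - P (-1)"])
    fix x :: real
    have "((\<lambda>x. P 1 - P (cos x)) has_real_derivative 0 - (1 - (cos x)\<^sup>2) ^ m * (- sin x)) (at x)"
      by (intro DERIV_diff DERIV_const DERIV_chain2[OF P]) (auto intro!: derivative_eq_intros)
    also have "0 - (1 - (cos x)\<^sup>2) ^ m * (- sin x) = sin x ^ b"
      by (simp add: b power_mult flip: sin_squared_eq)
    finally show "((\<lambda>x. P 1 - P (cos x)) has_real_derivative sin x ^ b) (at x)" .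
    show "0 \<le> P 1 - P (cos x)" using mono[of "cos x" 1] by simp
    show "P 1 - P (cos x) \<le> P 1 - P (-1)" using mono[of "-1" "cos x"] by simp
  qed simp
qed

text \<open>For odd \<open>b\<close> the integrand changes sign; integrating by parts against a nonnegative primitive
  of \<open>sin\<^sup>b\<close> exhibits the integral as that of a nonnegative function.\<close>

lemma improper_sin_power_nonneg:
  fixes s :: real
  assumes "improper_primitive (\<lambda>x. sin x ^ b / x powr s) I" "0 < s" "s < real b + 1"
  shows "0 \<le> I"
proof -
  obtain F A B where F: "\<And>x. x > 0 \<Longrightarrow> (F has_real_derivative sin x ^ b / x powr s) (at x)"
    "(F \<longlongrightarrow> A) (at_right 0)" "(F \<longlongrightarrow> B) at_top" "I = B - A"
    using assms(1) unfolding improper_primitive_def by blast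
  have "A \<le> B"
  proof (cases "even b")
    case True
    then show ?thesis
      using F by (intro tendsto_le_of_derivative_nonneg[OF F(1) _ F(2,3)]) (auto simp: zero_le_even_power)
  next
    case False
    then obtain W C where W: "\<And>x. (W has_real_derivative sin x ^ b) (at x)" "\<And>x. 0 \<le> W x"
      "\<And>x. W x \<le> C" "W 0 = 0"
      using odd_sin_power_nonneg_primitive by blast
    \<comment> \<open>Its derivative is \<open>s * W x / x powr (s + 1)\<close>, which is
      nonnegative, and the subtracted term vanishes at both ends, so \<open>G\<close> has the limits
      of \<open>F\<close>.\<close>
    define G where "G = (\<lambda>x. F x - W x / x powr s)"
    have "\<bar>W x\<bar> \<le> 1 * x ^ (b + 1)" if x: "0 < x" "x \<le> 1" for x
    proof -
      \<comment> \<open>The mean value theorem gives \<open>W\<close> one order of vanishing more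
        than the \<open>b\<close>-th power of the sine, which beats \<open>x powr s\<close> as
        \<open>s < b + 1\<close>.\<close>
      obtain z where z: "0 < z" "z < x" "W x - W 0 = (x - 0) * sin z ^ b"
        using MVT2[OF x(1), of W "\<lambda>x. sin x ^ b"] W(1) by blast
      have "sin z ^ b \<le> \<bar>sin z\<bar> ^ b" by (simp flip: power_abs)
      also have "\<dots> \<le> x ^ b"
        using z abs_sin_x_le_abs_x[of z] by (intro power_mono) auto
      finally have "W x \<le> x * x ^ b" using z x W(4) by simp
      then show ?thesis using W(2)[of x] by simp
    qed
    then have "((\<lambda>x. W x / x powr s) \<longlongrightarrow> 0) (at_right 0)"
      using assms(3) by (intro tendsto_0_div_powr[of W 1 "b + 1"]) auto
    then have lim0: "(G \<longlongrightarrow> A - 0) (at_right 0)"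
      unfolding G_def by (intro tendsto_diff F)
    have "((\<lambda>x. W x / x powr s) \<longlongrightarrow> 0) at_top"
    proof (rule Lim_null_comparison)
      show "((\<lambda>x. C * x powr (-s)) \<longlongrightarrow> 0) at_top"
        using tendsto_mult[OF tendsto_const tendsto_neg_powr[OF _ filterlim_ident], of "-s" C] assms(2) by simp
      show "\<forall>\<^sub>F x in at_top. norm (W x / x powr s) \<le> C * x powr (-s)"
        using W by (auto simp: powr_minus divide_simps)
    qed
    then have lim1: "(G \<longlongrightarrow> B - 0) at_top"
      unfolding G_def by (intro tendsto_diff F)
    have "(G has_real_derivative s * W x / x powr (s + 1)) (at x)" if "x > 0" for x
      unfolding G_def using that
      by (auto intro!: derivative_eq_intros F W simp: powr_add powr_diff field_simps)
    then have "A - 0 \<le> B - 0"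
      by (rule tendsto_le_of_derivative_nonneg[OF _ _ lim0 lim1]) (use W assms(2) in auto)
    then show ?thesis by simp
  qed
  then show ?thesis using F(4) by simp
qed

section \<open>Assembly of the formula\<close>

theorem proposition2:
  fixes a b :: nat and \<rho> :: real
  assumes "b > 0" and "0 < \<rho>" and "\<rho> < 1"
    and "improper_integral_converges (\<lambda>x. sin x ^ b / x powr (real a + \<rho>))"
  shows "has_improper_integral (\<lambda>x. sin x ^ b / x powr (real a + \<rho>))
    (pi / (2 ^ (b - 1) * Gamma (real a + \<rho>)) *
     \<bar>\<Sum>k = 1..b. real k powr (real a + \<rho> - 1) * t_coeff b k * real (b choose ((b - k) div 2)) *
        (sin ((real a + real b + \<rho>) * pi / 2) / sin (\<rho> * pi))\<bar>)"
proof -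
  let ?s = "real a + \<rho>"
  have "continuous_on {0<..} (\<lambda>x. sin x ^ b / x powr ?s)" by (intro continuous_intros) auto
  then obtain I0 where I0: "improper_primitive (\<lambda>x. sin x ^ b / x powr ?s) I0"
    using assms(4) has_improper_integral_imp_improper_primitive
    unfolding improper_integral_converges_def by blast
  then have "a \<le> b" using assms by (intro improper_sin_power_exponent_le) auto
  obtain c0 where expand: "\<And>x. sin x ^ b = c0 + (-1) ^ (b div 2) / 2 ^ (b - 1) *
      (\<Sum>k=1..b. t_coeff b k * real (b choose ((b - k) div 2)) * cos (real k * x - real b * pi / 2))"
    using sin_power_eq_t_coeff_sum[OF assms(1)] by blast
  define K :: real where "K = (-1) ^ (b div 2) / 2 ^ (b - 1)"
  define d where "d = (\<lambda>k. t_coeff b k * real (b choose ((b - k) div 2)))"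
  \<comment> \<open>The \<open>i\<close>-th derivative of the sine power: each differentiation
    multiplies by the frequency \<open>k\<close>, advances the phase by \<open>pi / 2\<close> and
    removes the constant.\<close>
  define D where "D = (\<lambda>i x. (if i = 0 then c0 else 0) +
      K * (\<Sum>k=1..b. d k * real k ^ i * cos (real k * x + (real i * pi / 2 - real b * pi / 2))))"
  define V where "V = K * (\<Sum>k=1..b. d k * real k ^ a * (real k powr (\<rho> - 1) *
      (pi * sin (pi * \<rho> / 2 - (real a * pi / 2 - real b * pi / 2)) / (Gamma \<rho> * sin (\<rho> * pi)))))"
  have D0: "D 0 x = sin x ^ b" for x
    unfolding D_def expand K_def d_def by simp
  have D_deriv: "(D i has_real_derivative D (Suc i) x) (at x)" for i x
  proof -
    have *: "cos (real k * x + (real (Suc i) * pi / 2 - real b * pi / 2)) =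
        - sin (real k * x + (real i * pi / 2 - real b * pi / 2))" for k
    proof -
      have "real k * x + (real (Suc i) * pi / 2 - real b * pi / 2) =
          (real k * x + (real i * pi / 2 - real b * pi / 2)) + pi / 2"
        by (simp add: field_simps)
      then show ?thesis by (simp only: cos_add cos_pi_half sin_pi_half)
    qed
    have "(D i has_real_derivative 0 + K * (\<Sum>k=1..b. d k * real k ^ i *
        (- sin (real k * x + (real i * pi / 2 - real b * pi / 2)) * real k))) (at x)"
      unfolding D_def
      by (intro DERIV_add DERIV_const DERIV_cmult DERIV_sum) (auto intro!: derivative_eq_intros)
    also have "0 + K * (\<Sum>k=1..b. d k * real k ^ i *
        (- sin (real k * x + (real i * pi / 2 - real b * pi / 2)) * real k)) = D (Suc i) x"
      unfolding D_def * by (simp add: mult_ac)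
    finally show ?thesis .
  qed
  have D_bounded: "\<exists>C. \<forall>x. \<bar>D i x\<bar> \<le> C" for i
  proof (intro exI allI)
    fix x
    let ?\<phi> = "real i * pi / 2 - real b * pi / 2"
    have "\<bar>\<Sum>k=1..b. d k * real k ^ i * cos (real k * x + ?\<phi>)\<bar> \<le>
        (\<Sum>k=1..b. \<bar>d k * real k ^ i * cos (real k * x + ?\<phi>)\<bar>)" by (rule sum_abs)
    also have "\<dots> \<le> (\<Sum>k=1..b. \<bar>d k * real k ^ i\<bar>)"
      unfolding abs_mult[of _ "cos _"] by (intro sum_mono mult_right_le_one_le) auto
    finally have "\<bar>K * (\<Sum>k=1..b. d k * real k ^ i * cos (real k * x + ?\<phi>))\<bar> \<le>
        \<bar>K\<bar> * (\<Sum>k=1..b. \<bar>d k * real k ^ i\<bar>)"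
      unfolding abs_mult[of K] by (intro mult_left_mono) auto
    then show "\<bar>D i x\<bar> \<le> \<bar>c0\<bar> + \<bar>K\<bar> * (\<Sum>k=1..b. \<bar>d k * real k ^ i\<bar>)"
      unfolding D_def by (auto intro: order_trans[OF abs_triangle_ineq])
  qed
  \<comment> \<open>The trigonometric sum does not show its zero at the origin; uniqueness of
    derivatives identifies it with the form supplied by
    \<open>sin_vanishing_derivative\<close>.\<close>
  have D_vanish: "sin_vanishing (b - i) (D i)" if "i \<le> b" for i
    using that
  proof (induction i)
    case 0
    have "D 0 = (\<lambda>x. 1 * sin x ^ b * cos x ^ 0)" by (simp add: D0 fun_eq_iff)
    then show ?case using sin_vanishing.monomial[of b b 1 0] by simp
  next
    case (Suc i)
    then have "sin_vanishing (Suc (b - Suc i)) (D i)" by (simp add: Suc_diff_Suc)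
    then obtain f' where f': "sin_vanishing (b - Suc i) f'" "\<And>x. (D i has_real_derivative f' x) (at x)"
      using sin_vanishing_derivative by blast
    have "f' = D (Suc i)"
      using DERIV_unique[OF f'(2) D_deriv] by (simp add: fun_eq_iff)
    then show ?case using f'(1) by simp
  qed
  have D_lim: "((\<lambda>x. D i x / x powr (real a - real i - 1 + \<rho>)) \<longlongrightarrow> 0) (at_right 0)" if "i < a" for i
  proof -
    have "i \<le> b" using that \<open>a \<le> b\<close> by simp
    then obtain C where "\<forall>x. 0 < x \<longrightarrow> x \<le> 1 \<longrightarrow> \<bar>D i x\<bar> \<le> C * x ^ (b - i)"
      using sin_vanishing_bound D_vanish by blast
    then show ?thesis
      \<comment> \<open>The exponent \<open>a - i - 1 + \<rho>\<close> is below \<open>b - i\<close>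
        because \<open>a \<le> b\<close> and \<open>\<rho> < 1\<close>.\<close>
      using that \<open>a \<le> b\<close> assms(3) by (intro tendsto_0_div_powr[of "D i" C "b - i"]) (auto simp: of_nat_diff)
  qed
  define E where "E = (\<lambda>x. K * (\<Sum>k=1..b. d k * real k ^ a *
      cos (real k * x + (real a * pi / 2 - real b * pi / 2))))"
  have D_a: "D a x = (if a = 0 then c0 else 0) + E x" for x
    by (simp add: D_def E_def)
  have cos_part: "improper_primitive (\<lambda>x. E x / x powr \<rho>) V"
  proof (rule improper_primitive_cong)
    show "improper_primitive (\<lambda>x. K * (\<Sum>k=1..b. d k * real k ^ a *
        (cos (real k * x + (real a * pi / 2 - real b * pi / 2)) / x powr \<rho>))) V"
      unfolding V_def using assms
      by (intro improper_primitive_cmult improper_primitive_sum improper_primitive_cos_scaled) auto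
  qed (simp add: E_def flip: sum_divide_distrib)
  \<comment> \<open>For \<open>a = 0\<close> the constant over \<open>x powr \<rho>\<close> is a
    difference of two convergent integrands.\<close>
  have c0: "c0 = 0" if "a = 0"
  proof (rule not_improper_primitive_const_div_powr[OF assms(3)])
    show "improper_primitive (\<lambda>x. c0 / x powr \<rho>) (I0 + (-1) * V)"
    proof (rule improper_primitive_cong)
      show "improper_primitive (\<lambda>x. sin x ^ b / x powr ?s + (-1) * (E x / x powr \<rho>)) (I0 + (-1) * V)"
        by (intro improper_primitive_add improper_primitive_cmult I0 cos_part)
      show "sin x ^ b / x powr ?s + (-1) * (E x / x powr \<rho>) = c0 / x powr \<rho>" for x
        using D_a[of x] D0[of x] that by (simp add: add_divide_distrib)
    qed
  qed
  have "improper_primitive (\<lambda>x. D a x / x powr \<rho>) V"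
    using cos_part c0 by (simp add: D_a)
  then have "improper_primitive (\<lambda>x. D 0 x / x powr ?s) (V * Gamma \<rho> / Gamma ?s)"
    using assms D_deriv D_bounded D_lim by (intro improper_primitive_iterated_by_parts) auto
  then have main: "improper_primitive (\<lambda>x. sin x ^ b / x powr ?s) (V * Gamma \<rho> / Gamma ?s)"
    by (simp add: D0)
  define S where "S = (\<Sum>k = 1..b. real k powr (?s - 1) * t_coeff b k * real (b choose ((b - k) div 2)) *
        (sin ((real a + real b + \<rho>) * pi / 2) / sin (\<rho> * pi)))"
  have G: "Gamma \<rho> > 0" "Gamma ?s > 0" using assms by (auto intro!: Gamma_real_pos)
  have sin_eq: "sin (pi * \<rho> / 2 - (real a * pi / 2 - real b * pi / 2)) =
      (-1) ^ a * sin ((real a + real b + \<rho>) * pi / 2)"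
  proof -
    have "sin (pi * \<rho> / 2 - (real a * pi / 2 - real b * pi / 2)) = sin ((real a + real b + \<rho>) * pi / 2 - real a * pi)"
      by (intro arg_cong[of _ _ sin]) (simp add: field_simps)
    also have "\<dots> = (-1) ^ a * sin ((real a + real b + \<rho>) * pi / 2)"
      by (simp add: sin_diff)
    finally show ?thesis .
  qed
  have "V * Gamma \<rho> = K * (-1) ^ a * pi * S"
  proof -
    \<comment> \<open>Here \<open>y\<close> and \<open>z\<close> stand for the two sines, so the
      comparison is purely algebraic.\<close>
    have "d k * real k ^ a * (real k powr (\<rho> - 1) * (pi * ((-1) ^ a * y) / (Gamma \<rho> * z))) * Gamma \<rho> =
        (-1) ^ a * pi * (real k powr (?s - 1) * t_coeff b k * real (b choose ((b - k) div 2)) * (y / z))"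
      if "k \<in> {1..b}" for k y z
    proof -
      have "real k powr (?s - 1) = real k ^ a * real k powr (\<rho> - 1)"
        using that powr_add[of "real k" "real a" "\<rho> - 1"] by (simp add: powr_realpow add_diff_eq)
      then show ?thesis using G(1) by (simp add: d_def)
    qed
    then have "(\<Sum>k=1..b. d k * real k ^ a * (real k powr (\<rho> - 1) * (pi * ((-1) ^ a *
        sin ((real a + real b + \<rho>) * pi / 2)) / (Gamma \<rho> * sin (\<rho> * pi))))) * Gamma \<rho> =
        (-1) ^ a * pi * S"
      unfolding S_def sum_distrib_left sum_distrib_right by (intro sum.cong refl)
    then show ?thesis
      unfolding V_def sin_eq by (simp only: mult.assoc)
  qed
  then have "V * Gamma \<rho> / Gamma ?s = ((-1) ^ (b div 2) * (-1) ^ a) * (pi / (2 ^ (b - 1) * Gamma ?s) * S)"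
    by (simp add: K_def)
  then have "\<bar>V * Gamma \<rho> / Gamma ?s\<bar> = pi / (2 ^ (b - 1) * Gamma ?s) * \<bar>S\<bar>"
    using G by (simp add: abs_mult)
  \<comment> \<open>The sign lemma applies since \<open>a \<le> b\<close> and
    \<open>\<rho> < 1\<close> give \<open>a + \<rho> < b + 1\<close>; it makes the value equal to
    its absolute value, in which the signs are lost.\<close>
  moreover have "0 \<le> V * Gamma \<rho> / Gamma ?s"
    using main assms \<open>a \<le> b\<close> by (intro improper_sin_power_nonneg[OF main]) auto
  ultimately have "V * Gamma \<rho> / Gamma ?s = pi / (2 ^ (b - 1) * Gamma ?s) * \<bar>S\<bar>"
    by (simp only: abs_of_nonneg)
  then show ?thesis
    using improper_primitive_imp_has_improper_integral[OF main] unfolding S_def by (simp only:)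
qed

end
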